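(* Let $n>0$ and let $C\subset S$ be a generic rational curve of degree $n$ in the Study quadric, passing through $1$. Then there exists a mechanism with revolute joints, having $2^n$ links and $n2^{n-1}$ joints, whose link graph is (isomorphic to) the 1-skeleton of the $n$-dimensional hypercube, such that $C$ is contained in the motion of one of its links.
   Context: Dual quaternions. Let $\mathbb{D}=\mathbb{R}+\epsilon\mathbb{R}$ with $\epsilon^2=0$ be the dual numbers, $\mathbb{H}$ the real quaternions, and $\mathbb{D}\mathbb{H}$ the algebra of quaternions with coefficients in $\mathbb{D}$ ($\epsilon$ central). Write $h=p+\epsilon q$ with $p,q\in\mathbb{H}$; $p$ is the primal part. The conjugate $\overline{h}$ is obtained by multiplying the vectorial part of $h$ by $-1$. Let $\mathbb{P}^7$ be the projectivization of $\mathbb{D}\mathbb{H}$ as a real 8-dimensional vector space; the Study quadric $S\subset\mathbb{P}^7$ is the set of classes of $h$ with $h\overline{h}\in\mathbb{R}$, and $E\subset S$ is the 3-space of classes with zero primal part. Multiplication makes $S\setminus E$ a group with identity the class of $1$, isomorphic to the group $\mathrm{SE}_3$ of direct Euclidean displacements of $\mathbb{R}^3$. A nonzero $h=p+\epsilon q$ is a rotation quaternion if $h\overline{h}\in\mathbb{R}$, $h+\overline{h}\in\mathbb{R}$ and $p\notin\mathbb{R}$; then the set of classes of $t-h$, $t\in\mathbb{P}^1=\mathbb{R}\cup\{\infty\}$ (the value at $\infty$ being the class of $1$), is the one-parameter subgroup of rotations about a fixed axis. Curves. $\mathbb{D}\mathbb{H}[t]$ is the polynomial ring in which $t$ commutes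 with the coefficients; for $P=\sum a_it^i$ put $\overline{P}=\sum\overline{a_i}t^i$. A motion polynomial is a monic $P\in\mathbb{D}\mathbb{H}[t]$ with $P\overline{P}\in\mathbb{R}[t]$; it is generic, if of degree $n>0$, when $P\overline{P}$ is a product of $n$ pairwise distinct monic quadratic polynomials in $\mathbb{R}[t]$ that are irreducible over $\mathbb{R}$. A rational curve $C\subset S$ of degree $n$ passing through $1$ admits a parametrization by a motion polynomial $P$ of degree $n$, i.e. $C$ is the image of $\mathbb{P}^1\to\mathbb{P}^7$, $t\mapsto[P(t)]$ (with $\infty\mapsto[1]$); $C$ is called generic if $P$ is generic. Mechanisms. A mechanism with revolute joints consists of a finite set of links, one of which is the base, and a set of joints, each connecting two links; the link graph has the links as nodes and the joints as edges. Each joint $J$ connecting links $L_1,L_2$ carries a rotation quaternion $h_J$, and the allowed relative poses of the two links are those in the rotation subgroup $\{[t-h_J]:t\in\mathbb{P}^1\}$. A configuration assigns to each link $L$ a pose $g_L\in S\setminus E$, with $g=1$ for the base, such that $g_{L_2}g_{L_1}^{-1}$ lies in the rotation subgroup of $J$ for each joint $J$ connecting $L_1$ and $L_2$. A curve $C$ is contained in the motion of a link $L_0$ if there is a rational one-parameter family of configurations, i.e. pose functions $\phi_L:\mathbb{P}^1\to S\setminus E$ for all links $L$, each induced by a polynomial in $\mathbb{D}\mathbb{H}[t]$, that form a configuration for every $t\in\mathbb{P}^1$, such that $\phi_{L_0}(\mathbb{P}^1)=C$. (The mechanism may have additional degrees of freedom, and axes of different joints are allowed to coincide.) *)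

theory Defs
  imports
    Complex_Main
    "HOL-Algebra.Group"
    "HOL-Library.FuncSet"
    "HOL-Computational_Algebra.Polynomial"
begin

section \<open>Dual numbers\<close>

datatype 'a dual_number = Dual (primal: 'a) (dualp: 'a)

instantiation dual_number :: (comm_ring_1) comm_ring_1
begin

definition "0 = Dual 0 0"
definition "1 = Dual 1 0"
definition "x + y = Dual (primal x + primal y) (dualp x + dualp y)"
definition "x - y = Dual (primal x - primal y) (dualp x - dualp y)"
definition "- x = Dual (- primal x) (- dualp x)"
definition "x * y = Dual (primal x * primal y) (primal x * dualp y + dualp x * primal y)"

instance
  by standard
    (simp_all add: zero_dual_number_def one_dual_number_def plus_dual_number_def
      minus_dual_number_def uminus_dual_number_def times_dual_number_def algebra_simps)

end

instantiation dual_number :: ("{comm_ring_1, real_algebra_1}") real_algebra_1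
begin

definition "c *\<^sub>R x = Dual (c *\<^sub>R primal x) (c *\<^sub>R dualp x)"

instance
  by standard
    (simp_all add: scaleR_dual_number_def plus_dual_number_def times_dual_number_def
      algebra_simps)

end

lemmas dual_number_defs =
  zero_dual_number_def one_dual_number_def plus_dual_number_def minus_dual_number_def
  uminus_dual_number_def times_dual_number_def scaleR_dual_number_def

lemma primal_dual_simps [simp]:
  "primal 0 = 0" "primal 1 = 1" "primal (x + y) = primal x + primal y"
  "primal (x - y) = primal x - primal y" "primal (- x) = - primal x"
  "primal (x * y) = primal x * primal y" "primal (c *\<^sub>R z) = c *\<^sub>R primal z"
  "dualp 0 = 0" "dualp 1 = 0" "dualp (x + y) = dualp x + dualp y"
  "dualp (x - y) = dualp x - dualp y" "dualp (- x) = - dualp x"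
  "dualp (x * y) = primal x * dualp y + dualp x * primal y"
  "dualp (c *\<^sub>R z) = c *\<^sub>R dualp z"
  by (simp_all add: dual_number_defs)


section \<open>Quaternions over a commutative ring\<close>

datatype 'a quaternion = Quat (qre: 'a) (qi: 'a) (qj: 'a) (qk: 'a)

instantiation quaternion :: (comm_ring_1) ring_1
begin

definition "0 = Quat 0 0 0 0"
definition "1 = Quat 1 0 0 0"
definition "x + y = Quat (qre x + qre y) (qi x + qi y) (qj x + qj y) (qk x + qk y)"
definition "x - y = Quat (qre x - qre y) (qi x - qi y) (qj x - qj y) (qk x - qk y)"
definition "- x = Quat (- qre x) (- qi x) (- qj x) (- qk x)"
definition "x * y = Quat
  (qre x * qre y - qi x * qi y - qj x * qj y - qk x * qk y)
  (qre x * qi y + qi x * qre y + qj x * qk y - qk x * qj y)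
  (qre x * qj y - qi x * qk y + qj x * qre y + qk x * qi y)
  (qre x * qk y + qi x * qj y - qj x * qi y + qk x * qre y)"

instance
  by standard
    (simp_all add: zero_quaternion_def one_quaternion_def plus_quaternion_def
      minus_quaternion_def uminus_quaternion_def times_quaternion_def algebra_simps)

end

instantiation quaternion :: ("{comm_ring_1, real_algebra_1}") real_algebra_1
begin

definition "c *\<^sub>R x = Quat (c *\<^sub>R qre x) (c *\<^sub>R qi x) (c *\<^sub>R qj x) (c *\<^sub>R qk x)"

instance
  by standard
    (simp_all add: scaleR_quaternion_def plus_quaternion_def times_quaternion_def
      algebra_simps)

end

lemmas quaternion_defs =
  zero_quaternion_def one_quaternion_def plus_quaternion_def minus_quaternion_def
  uminus_quaternion_def times_quaternion_def scaleR_quaternion_def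

definition qconj :: "'a::comm_ring_1 quaternion \<Rightarrow> 'a quaternion"
  where "qconj h = Quat (qre h) (- qi h) (- qj h) (- qk h)"

lemma qconj_mult: "qconj (x * y) = qconj y * qconj x"
  by (simp add: qconj_def times_quaternion_def algebra_simps)

lemma qconj_qconj [simp]: "qconj (qconj x) = x"
  by (simp add: qconj_def)

lemma qconj_0 [simp]: "qconj 0 = 0"
  by (simp add: qconj_def quaternion_defs)

lemma qconj_1 [simp]: "qconj 1 = 1"
  by (simp add: qconj_def quaternion_defs)

lemma mult_qconj_commute: "qconj x * x = x * qconj x"
  by (simp add: qconj_def times_quaternion_def algebra_simps)


section \<open>Dual quaternions, the Study quadric and its group\<close>

type_synonym dual_quat = "real dual_number quaternion"

abbreviation primal_part :: "dual_quat \<Rightarrow> real quaternion"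
  where "primal_part \<equiv> map_quaternion primal"

text \<open>
  A point of the projective space over the real vector space of dual quaternions is a
  one-dimensional subspace; the class of a nonzero \<open>h\<close> is the line spanned by \<open>h\<close>.
  Note that the class of \<open>0\<close> is the zero subspace, which is not a point.
\<close>

definition proj :: "dual_quat \<Rightarrow> dual_quat set"
  where "proj h = span {h}"

text \<open>In a real algebra, \<open>\<real>\<close> is the set of multiples of \<open>1\<close>, i.e. the embedded reals.\<close>

definition study_quadric :: "dual_quat set set"
  where "study_quadric = {proj h | h. h \<noteq> 0 \<and> h * qconj h \<in> \<real>}"

definition exceptional_space :: "dual_quat set set"
  where "exceptional_space = {proj h | h. h \<noteq> 0 \<and> primal_part h = 0}"

text \<open>
  The elementwise product of the lines spanned by \<open>x\<close> and \<open>y\<close> is the line spanned by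
  \<open>x * y\<close>, so the multiplication below is the one induced on classes.
\<close>

definition study_group :: "dual_quat set monoid"
  where "study_group =
    \<lparr> carrier = study_quadric - exceptional_space,
      monoid.mult = (\<lambda>X Y. {x * y | x y. x \<in> X \<and> y \<in> Y}),
      one = proj 1 \<rparr>"

lemma proj_eq: "proj h = range (\<lambda>c. c *\<^sub>R h)"
  by (simp add: proj_def span_singleton)

lemma mem_proj_self: "h \<in> proj h"
  by (simp add: proj_def span_base)

lemma proj_scaleR: "c \<noteq> 0 \<Longrightarrow> proj (c *\<^sub>R h) = proj h"
  unfolding proj_eq
  by (auto simp: image_iff) (metis nonzero_divide_eq_eq scaleR_scaleR)

lemma proj_eqD:
  assumes "proj x = proj y" "x \<noteq> 0"
  obtains c where "c \<noteq> 0" "x = c *\<^sub>R y"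
proof -
  have "x \<in> proj y" using assms(1) mem_proj_self by blast
  then obtain c where "x = c *\<^sub>R y" by (auto simp: proj_eq)
  with assms(2) that show ?thesis by (metis scaleR_zero_left)
qed

lemma proj_mult: "{a * b | a b. a \<in> proj x \<and> b \<in> proj y} = proj (x * y)"
proof (rule equalityI; rule subsetI)
  fix z assume "z \<in> proj (x * y)"
  then obtain c where "z = (c *\<^sub>R x) * y" by (auto simp: proj_eq)
  moreover have "c *\<^sub>R x \<in> proj x" unfolding proj_eq by (rule rangeI)
  ultimately show "z \<in> {a * b | a b. a \<in> proj x \<and> b \<in> proj y}"
    using mem_proj_self by blast
qed (auto simp: proj_eq)

lemma primal_part_scaleR: "primal_part (c *\<^sub>R h) = c *\<^sub>R primal_part h"
  by (cases h) (simp add: scaleR_quaternion_def)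

lemma qconj_scaleR: "qconj (c *\<^sub>R h) = c *\<^sub>R qconj (h :: dual_quat)"
  by (simp add: qconj_def scaleR_quaternion_def dual_number_defs)

lemma primal_part_0 [simp]: "primal_part 0 = 0"
  by (simp add: zero_quaternion_def)

lemma Reals_scaleR: "x \<in> \<real> \<Longrightarrow> c *\<^sub>R x \<in> \<real>" for x :: "'a::real_algebra_1"
  by (auto elim!: Reals_cases simp: scaleR_conv_of_real)

lemma mult_qconj_scaleR: "(c *\<^sub>R h) * qconj (c *\<^sub>R h) = (c * c) *\<^sub>R (h * qconj h)"
  for h :: dual_quat
  by (simp add: qconj_scaleR)

lemma proj_in_exceptional: "proj h \<in> exceptional_space \<longleftrightarrow> h \<noteq> 0 \<and> primal_part h = 0"
proof
  assume "proj h \<in> exceptional_space"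
  then obtain g where g: "proj g = proj h" "g \<noteq> 0" "primal_part g = 0"
    unfolding exceptional_space_def by auto
  then obtain c where "c \<noteq> 0" "g = c *\<^sub>R h" by (metis proj_eqD)
  with g show "h \<noteq> 0 \<and> primal_part h = 0" by (auto simp: primal_part_scaleR)
qed (auto simp: exceptional_space_def)

lemma proj_in_study_quadric: "proj h \<in> study_quadric \<longleftrightarrow> h \<noteq> 0 \<and> h * qconj h \<in> \<real>"
proof
  assume "proj h \<in> study_quadric"
  then obtain g where g: "proj g = proj h" "g \<noteq> 0" "g * qconj g \<in> \<real>"
    unfolding study_quadric_def by auto
  then obtain c where c: "c \<noteq> 0" "g = c *\<^sub>R h" by (metis proj_eqD)
  have "h * qconj h = (1 / (c * c)) *\<^sub>R (g * qconj g)"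
    using c by (simp add: mult_qconj_scaleR del: mult_scaleR_left mult_scaleR_right)
  then have "h * qconj h \<in> \<real>" using Reals_scaleR[OF g(3)] by simp
  with g c show "h \<noteq> 0 \<and> h * qconj h \<in> \<real>" by auto
qed (auto simp: study_quadric_def)

lemma proj_in_carrier:
  "proj h \<in> carrier study_group \<longleftrightarrow> h * qconj h \<in> \<real> \<and> primal_part h \<noteq> 0"
  by (auto simp: study_group_def proj_in_exceptional proj_in_study_quadric)

lemma carrier_cases:
  assumes "X \<in> carrier study_group"
  obtains h where "X = proj h" "h * qconj h \<in> \<real>" "primal_part h \<noteq> 0"
proof -
  from assms obtain h where "X = proj h"
    by (auto simp: study_group_def study_quadric_def)
  with assms that show ?thesis by (auto simp: proj_in_carrier)
qed

lemma study_group_mult: "proj x \<otimes>\<^bsub>study_group\<^esub> proj y = proj (x * y)"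
  by (simp add: study_group_def proj_mult)

lemma study_group_one: "\<one>\<^bsub>study_group\<^esub> = proj 1"
  by (simp add: study_group_def)

lemma mult_qconj_real_nz:
  assumes "h * qconj h \<in> \<real>" and "primal_part h \<noteq> 0"
  obtains r where "r \<noteq> 0" "h * qconj h = of_real r"
proof -
  from assms(1) obtain r where r: "h * qconj h = of_real r" by (auto elim: Reals_cases)
  obtain a b c d where p: "primal (qre h) = a" "primal (qi h) = b" "primal (qj h) = c"
    "primal (qk h) = d" by blast
  have "primal (qre (h * qconj h)) = a * a + b * b + c * c + d * d"
    by (simp add: times_quaternion_def qconj_def p)
  then have eq: "r = a\<^sup>2 + b\<^sup>2 + c\<^sup>2 + d\<^sup>2"
    unfolding r by (simp add: of_real_def scaleR_quaternion_def one_quaternion_def power2_eq_square)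
  have "a \<noteq> 0 \<or> b \<noteq> 0 \<or> c \<noteq> 0 \<or> d \<noteq> 0"
    using assms(2) p by (cases h) (auto simp: zero_quaternion_def)
  then have "r \<noteq> 0"
    unfolding eq by (smt (verit) zero_le_power2 zero_less_power2)
  with r that show ?thesis by blast
qed

lemma mult_qconj_real_nzD:
  assumes "h * qconj h = of_real r" "r \<noteq> 0"
  shows "primal_part h \<noteq> 0"
proof
  assume "primal_part h = 0"
  then have "primal (qre h) = 0" "primal (qi h) = 0" "primal (qj h) = 0" "primal (qk h) = 0"
    by (cases h; simp add: zero_quaternion_def)+
  then have "primal (qre (h * qconj h)) = 0"
    by (simp add: times_quaternion_def qconj_def)
  with assms show False
    by (simp add: of_real_def scaleR_quaternion_def one_quaternion_def)
qed

lemma norm_mult_of_real: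
  assumes "x * qconj x = of_real r" "y * qconj y = of_real s"
  shows "(x * y) * qconj (x * y) = (of_real (r * s) :: dual_quat)"
proof -
  have "(x * y) * qconj (x * y) = x * (y * qconj y) * qconj x"
    by (simp add: qconj_mult mult.assoc)
  also have "\<dots> = of_real s * (x * qconj x)"
    by (simp add: assms(2) of_real_def)
  finally show ?thesis by (simp add: assms(1) mult.commute flip: of_real_mult)
qed

lemma group_study_group: "group study_group"
proof (rule groupI)
  fix X Y assume "X \<in> carrier study_group" "Y \<in> carrier study_group"
  then obtain x y where x: "X = proj x" "x * qconj x \<in> \<real>" "primal_part x \<noteq> 0"
    and y: "Y = proj y" "y * qconj y \<in> \<real>" "primal_part y \<noteq> 0"
    by (metis carrier_cases)
  obtain r s where rs: "r \<noteq> 0" "x * qconj x = of_real r" "s \<noteq> 0" "y * qconj y = of_real s"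
    using mult_qconj_real_nz x y by metis
  have xy: "(x * y) * qconj (x * y) = of_real (r * s)"
    using norm_mult_of_real rs by blast
  then have "primal_part (x * y) \<noteq> 0" using mult_qconj_real_nzD[OF xy] rs by simp
  with xy show "X \<otimes>\<^bsub>study_group\<^esub> Y \<in> carrier study_group"
    by (simp add: x y study_group_mult proj_in_carrier del: of_real_mult)
next
  have "primal_part 1 \<noteq> 0" by (simp add: quaternion_defs)
  then show "\<one>\<^bsub>study_group\<^esub> \<in> carrier study_group"
    by (simp add: study_group_one proj_in_carrier)
next
  fix X Y Z
  assume "X \<in> carrier study_group" "Y \<in> carrier study_group" "Z \<in> carrier study_group"
  then show "X \<otimes>\<^bsub>study_group\<^esub> Y \<otimes>\<^bsub>study_group\<^esub> Z = X \<otimes>\<^bsub>study_group\<^esub> (Y \<otimes>\<^bsub>study_group\<^esub> Z)"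
    by (elim carrier_cases) (simp add: study_group_mult mult.assoc)
next
  fix X assume "X \<in> carrier study_group"
  then show "\<one>\<^bsub>study_group\<^esub> \<otimes>\<^bsub>study_group\<^esub> X = X"
    by (elim carrier_cases) (simp add: study_group_mult study_group_one)
next
  fix X assume "X \<in> carrier study_group"
  then obtain x where x: "X = proj x" "x * qconj x \<in> \<real>" "primal_part x \<noteq> 0"
    by (metis carrier_cases)
  then obtain r where r: "r \<noteq> 0" "x * qconj x = of_real r" using mult_qconj_real_nz by metis
  then have r': "qconj x * qconj (qconj x) = of_real r" by (simp add: mult_qconj_commute)
  then have "proj (qconj x) \<in> carrier study_group"
    unfolding proj_in_carrier using mult_qconj_real_nzD r(1) by auto
  moreover have "proj (qconj x) \<otimes>\<^bsub>study_group\<^esub> X = \<one>\<^bsub>study_group\<^esub>"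
    using r r' by (simp add: x study_group_mult study_group_one of_real_def proj_scaleR)
  ultimately show "\<exists>Y\<in>carrier study_group. Y \<otimes>\<^bsub>study_group\<^esub> X = \<one>\<^bsub>study_group\<^esub>" by blast
qed


section \<open>Rotations\<close>

definition rotation_quaternion :: "dual_quat \<Rightarrow> bool"
  where "rotation_quaternion h \<longleftrightarrow>
    h \<noteq> 0 \<and> h * qconj h \<in> \<real> \<and> h + qconj h \<in> \<real> \<and> primal_part h \<notin> \<real>"

text \<open>The real projective line is \<open>real option\<close>, with \<open>None\<close> in the role of \<open>\<infinity>\<close>.\<close>

type_synonym proj_line = "real option"

definition rotation_subgroup :: "dual_quat \<Rightarrow> dual_quat set set"
  where "rotation_subgroup h =
    range (\<lambda>t :: proj_line. case t of None \<Rightarrow> proj 1 | Some s \<Rightarrow> proj (of_real s - h))"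


section \<open>Motion polynomials and rational curves\<close>

text \<open>
  The library supplies multiplication and evaluation of polynomials for commutative
  coefficient rings only. Here the coefficients do not commute with each other, while the
  indeterminate is central and takes real values.
\<close>

definition poly_prod :: "'a::ring poly \<Rightarrow> 'a poly \<Rightarrow> 'a poly"
  where "poly_prod P Q = Abs_poly (\<lambda>k. \<Sum>i\<le>k. coeff P i * coeff Q (k - i))"

lemma coeff_poly_prod: "coeff (poly_prod P Q) k = (\<Sum>i\<le>k. coeff P i * coeff Q (k - i))"
proof -
  have "(\<Sum>i\<le>k. coeff P i * coeff Q (k - i)) = 0" if "k > degree P + degree Q" for k
    using that by (intro sum.neutral ballI) (metis add_le_mono coeff_eq_0 le_add_diff_inverse
        mult_zero_left mult_zero_right not_le atMost_iff)
  then show ?thesis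
    unfolding poly_prod_def by (subst coeff_Abs_poly) auto
qed

definition poly_at :: "'a::real_algebra_1 poly \<Rightarrow> real \<Rightarrow> 'a"
  where "poly_at P t = (\<Sum>i\<le>degree P. t ^ i *\<^sub>R coeff P i)"

definition motion_polynomial :: "dual_quat poly \<Rightarrow> bool"
  where "motion_polynomial P \<longleftrightarrow>
    lead_coeff P = 1 \<and>
    (\<exists>N :: real poly. poly_prod P (map_poly qconj P) = map_poly of_real N)"

definition generic_motion_polynomial :: "dual_quat poly \<Rightarrow> bool"
  where "generic_motion_polynomial P \<longleftrightarrow>
    motion_polynomial P \<and> degree P > 0 \<and>
    (\<exists>Ms :: real poly set.
       finite Ms \<and> card Ms = degree P \<and>
       (\<forall>M\<in>Ms. lead_coeff M = 1 \<and> degree M = 2 \<and> irreducible M) \<and>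
       poly_prod P (map_poly qconj P) = map_poly of_real (\<Prod>M\<in>Ms. M))"

text \<open>
  The map from the projective line induced by a polynomial: by homogeneity, the value at
  \<open>\<infinity>\<close> is the class of the leading coefficient. At a zero of \<open>P\<close> the value is \<open>{0}\<close>,
  which is not a point of projective space.
\<close>

definition induced_map :: "dual_quat poly \<Rightarrow> proj_line \<Rightarrow> dual_quat set"
  where "induced_map P t =
    (case t of None \<Rightarrow> proj (lead_coeff P) | Some s \<Rightarrow> proj (poly_at P s))"

text \<open>
  A rational curve of degree \<open>n\<close> in the Study quadric through \<open>proj 1\<close> is given by a
  parametrization by a motion polynomial of degree \<open>n\<close>; it contains \<open>proj 1\<close> as the value
  at \<open>\<infinity>\<close>.
\<close>

definition generic_rational_curve :: "nat \<Rightarrow> dual_quat set set \<Rightarrow> bool"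
  where "generic_rational_curve n C \<longleftrightarrow>
    (\<exists>P. generic_motion_polynomial P \<and> degree P = n \<and> C = range (induced_map P))"

lemma proj_1_mem_generic_rational_curve:
  assumes "generic_rational_curve n C"
  shows "proj 1 \<in> C"
proof -
  from assms obtain P where "lead_coeff P = 1" "C = range (induced_map P)"
    unfolding generic_rational_curve_def generic_motion_polynomial_def motion_polynomial_def
    by blast
  moreover from this have "proj 1 = induced_map P None" by (simp add: induced_map_def)
  ultimately show ?thesis by blast
qed


section \<open>Mechanisms with revolute joints\<close>

text \<open>
  The joints form an index set of their own, so that a pair of links may be connected by
  several joints; \<open>ends J\<close> is the unordered pair of links connected by \<open>J\<close>.
\<close>

record ('l, 'j) mechanism =
  links :: "'l set"
  base :: 'l
  joints :: "'j set"
  ends :: "'j \<Rightarrow> 'l set"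
  joint_quat :: "'j \<Rightarrow> dual_quat"

definition revolute_mechanism :: "('l, 'j) mechanism \<Rightarrow> bool"
  where "revolute_mechanism M \<longleftrightarrow>
    finite (links M) \<and> base M \<in> links M \<and>
    (\<forall>J\<in>joints M. ends M J \<subseteq> links M \<and> card (ends M J) = 2 \<and>
       rotation_quaternion (joint_quat M J))"

definition configuration :: "('l, 'j) mechanism \<Rightarrow> ('l \<Rightarrow> dual_quat set) \<Rightarrow> bool"
  where "configuration M g \<longleftrightarrow>
    (\<forall>L\<in>links M. g L \<in> carrier study_group) \<and>
    g (base M) = \<one>\<^bsub>study_group\<^esub> \<and>
    (\<forall>J\<in>joints M. \<forall>L1 L2. ends M J = {L1, L2} \<longrightarrow>
       g L2 \<otimes>\<^bsub>study_group\<^esub> inv\<^bsub>study_group\<^esub> (g L1) \<in> rotation_subgroup (joint_quat M J))"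

definition contained_in_motion ::
    "dual_quat set set \<Rightarrow> ('l, 'j) mechanism \<Rightarrow> 'l \<Rightarrow> bool"
  where "contained_in_motion C M L0 \<longleftrightarrow>
    (\<exists>\<phi> :: 'l \<Rightarrow> proj_line \<Rightarrow> dual_quat set.
       (\<forall>L\<in>links M. \<exists>F. \<phi> L = induced_map F) \<and>
       (\<forall>t. configuration M (\<lambda>L. \<phi> L t)) \<and>
       range (\<phi> L0) = C)"


section \<open>The 1-skeleton of the hypercube\<close>

definition cube_vertices :: "nat \<Rightarrow> (nat \<Rightarrow> nat) set"
  where "cube_vertices n = {..<n} \<rightarrow>\<^sub>E {0, 1}"

definition cube_edges :: "nat \<Rightarrow> (nat \<Rightarrow> nat) set set"
  where "cube_edges n =
    {{u, v} | u v. u \<in> cube_vertices n \<and> v \<in> cube_vertices n \<and> (\<exists>!i. i < n \<and> u i \<noteq> v i)}"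

text \<open>
  An isomorphism of multigraphs: bijective on links and, via the induced map on unordered
  pairs, bijective from joints to edges.
\<close>

definition link_graph_is_hypercube :: "nat \<Rightarrow> ('l, 'j) mechanism \<Rightarrow> bool"
  where "link_graph_is_hypercube n M \<longleftrightarrow>
    (\<exists>f. bij_betw f (links M) (cube_vertices n) \<and>
         bij_betw (\<lambda>J. f ` ends M J) (joints M) (cube_edges n))"

end

theory Submission
  imports
    Defs
    "HOL-Computational_Algebra.Polynomial_Factorial"
    "HOL-Computational_Algebra.Field_as_Ring"
begin

text \<open>
  Let \<open>P\<close> be a generic motion polynomial and let \<open>S\<close> be the set of the irreducible
  quadratic factors of its norm \<open>P * qconj P\<close>. The links of the mechanism correspond to the
  subsets \<open>T\<close> of \<open>S\<close>, and the link \<open>T\<close> moves along the curve given by the right factor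
  \<open>P\<^sub>T\<close> of \<open>P\<close> with norm \<open>\<Prod>T\<close>. The base is the link for \<open>T = {}\<close>, with \<open>P\<^sub>T = 1\<close>,
  and the link moving along the given curve is the one for \<open>T = S\<close>, with \<open>P\<^sub>T = P\<close>.

  Such right factors exist because each \<open>M \<in> S\<close> splits off a linear right factor
  (\<open>motion_linear_factor\<close>), which applies repeatedly to the remaining left factors. They are
  unique (\<open>motion_right_factor_unique\<close>) because the products of disjoint subsets of \<open>S\<close> are
  coprime. Applying existence to \<open>P\<^sub>T\<close> and comparing by uniqueness gives, for
  \<open>M \<in> T\<close>, a factorization \<open>P\<^sub>T = (t - h) * P\<^bsub>T - {M}\<^esub>\<close> where \<open>t - h\<close> has norm
  \<open>M\<close> (\<open>right_factor_step\<close>). As \<open>M\<close> has no real root, \<open>h\<close> is a rotation quaternion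
  (\<open>motion_linear_rotation\<close>), and it serves as the joint between the links \<open>T - {M}\<close> and
  \<open>T\<close>. The pairs \<open>(T - {M}, T)\<close> are the edges of the hypercube on \<open>S\<close>.
\<close>

section \<open>Component calculus and the norm\<close>

lemma quaternion_eq_iff: "x = y \<longleftrightarrow> qre x = qre y \<and> qi x = qi y \<and> qj x = qj y \<and> qk x = qk y"
  by (auto intro: quaternion.expand)

lemma dual_number_eq_iff: "x = y \<longleftrightarrow> primal x = primal y \<and> dualp x = dualp y"
  by (auto intro: dual_number.expand)

lemma quaternion_sel_simps [simp]:
  "qre 0 = 0" "qi 0 = 0" "qj 0 = 0" "qk 0 = 0"
  "qre 1 = 1" "qi 1 = 0" "qj 1 = 0" "qk 1 = 0"
  "qre (x + y) = qre x + qre y" "qi (x + y) = qi x + qi y"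
  "qj (x + y) = qj x + qj y" "qk (x + y) = qk x + qk y"
  "qre (x - y) = qre x - qre y" "qi (x - y) = qi x - qi y"
  "qj (x - y) = qj x - qj y" "qk (x - y) = qk x - qk y"
  "qre (- x) = - qre x" "qi (- x) = - qi x" "qj (- x) = - qj x" "qk (- x) = - qk x"
  "qre (x * y) = qre x * qre y - qi x * qi y - qj x * qj y - qk x * qk y"
  "qi (x * y) = qre x * qi y + qi x * qre y + qj x * qk y - qk x * qj y"
  "qj (x * y) = qre x * qj y - qi x * qk y + qj x * qre y + qk x * qi y"
  "qk (x * y) = qre x * qk y + qi x * qj y - qj x * qi y + qk x * qre y"
  by (simp_all add: quaternion_defs)

lemma dual_number_two [simp]: "primal 2 = 2" "dualp 2 = 0"
  using primal_dual_simps(3)[of 1 1] primal_dual_simps(10)[of 1 1] by simp_all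

lemma quaternion_scaleR_sel [simp]:
  "qre (c *\<^sub>R z) = c *\<^sub>R qre z" "qi (c *\<^sub>R z) = c *\<^sub>R qi z"
  "qj (c *\<^sub>R z) = c *\<^sub>R qj z" "qk (c *\<^sub>R z) = c *\<^sub>R qk z"
  by (simp_all add: scaleR_quaternion_def)

lemma qconj_sel [simp]:
  "qre (qconj x) = qre x" "qi (qconj x) = - qi x" "qj (qconj x) = - qj x" "qk (qconj x) = - qk x"
  by (simp_all add: qconj_def)

lemma quaternion_sum_sel:
  "qre (sum f A) = (\<Sum>a\<in>A. qre (f a))" "qi (sum f A) = (\<Sum>a\<in>A. qi (f a))"
  "qj (sum f A) = (\<Sum>a\<in>A. qj (f a))" "qk (sum f A) = (\<Sum>a\<in>A. qk (f a))"
  by (induction A rule: infinite_finite_induct; simp)+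

lemma dual_sum_sel:
  "primal (sum f A) = (\<Sum>a\<in>A. primal (f a))" "dualp (sum f A) = (\<Sum>a\<in>A. dualp (f a))"
  by (induction A rule: infinite_finite_induct; simp)+

text \<open>
  The norm \<open>h * qconj h\<close> of a quaternion, read as an element of the coefficient ring. Since
  that ring is commutative, the norm is multiplicative. A nonzero dual quaternion represents a point of
  the Study quadric exactly when its norm has no dual part.
\<close>

definition qnorm :: "'a::comm_ring_1 quaternion \<Rightarrow> 'a"
  where "qnorm x = qre x * qre x + qi x * qi x + qj x * qj x + qk x * qk x"

lemma mult_qconj_qnorm: "x * qconj x = Quat (qnorm x) 0 0 0"
  by (simp add: quaternion_eq_iff qnorm_def algebra_simps)

lemma qconj_mult_qnorm: "qconj x * x = Quat (qnorm x) 0 0 0"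
  by (simp add: mult_qconj_commute mult_qconj_qnorm)

lemma qnorm_mult: "qnorm (x * y) = qnorm x * qnorm y"
  by (simp add: qnorm_def algebra_simps)

lemma qnorm_one [simp]: "qnorm 1 = 1"
  by (simp add: qnorm_def)

lemma of_real_quat: "of_real r = Quat (Dual r 0) 0 0 (0 :: real dual_number)"
  by (simp add: of_real_def quaternion_eq_iff dual_number_eq_iff)

section \<open>Polynomials with dual quaternion coefficients as quaternions over dual polynomials\<close>

text \<open>
  The ring of polynomials in a central indeterminate with dual quaternion coefficients is
  represented as the quaternions over \<open>\<real>[t] + \<epsilon>\<real>[t]\<close>. This makes it an
  instance of \<open>ring_1\<close>, and reduces division by a real polynomial to division in
  \<open>\<real>[t]\<close> of each of the eight components.
\<close>

type_synonym quat_poly = "real poly dual_number quaternion"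

text \<open>The embedding of \<open>\<real>[t]\<close>, whose image is central.\<close>

definition qembed :: "real poly \<Rightarrow> quat_poly"
  where "qembed c = Quat (Dual c 0) 0 0 0"

text \<open>The constant polynomial with a given value.\<close>

definition qconst :: "dual_quat \<Rightarrow> quat_poly"
  where "qconst = map_quaternion (map_dual_number (\<lambda>r. [:r:]))"

text \<open>The coefficient of \<open>t ^ k\<close>.\<close>

definition qcoeff :: "quat_poly \<Rightarrow> nat \<Rightarrow> dual_quat"
  where "qcoeff x k = map_quaternion (map_dual_number (\<lambda>p. coeff p k)) x"

text \<open>Evaluation at a real number; a ring homomorphism, because reals are central.\<close>

definition qeval :: "real \<Rightarrow> quat_poly \<Rightarrow> dual_quat"
  where "qeval t = map_quaternion (map_dual_number (\<lambda>p. poly p t))"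

lemmas map_sels = quaternion.map_sel dual_number.map_sel

lemma qconst_mult: "qconst (a * b) = qconst a * qconst b"
  and qconst_one: "qconst 1 = 1"
  by (simp_all add: qconst_def quaternion_eq_iff dual_number_eq_iff map_sels algebra_simps)

lemma qeval_mult: "qeval t (x * y) = qeval t x * qeval t y"
  and qeval_one: "qeval t 1 = 1"
  by (simp_all add: qeval_def quaternion_eq_iff dual_number_eq_iff map_sels)

lemma qnorm_qeval: "qnorm (qeval t x) = map_dual_number (\<lambda>p. poly p t) (qnorm x)"
  by (simp add: qeval_def qnorm_def dual_number_eq_iff map_sels)

lemma qcoeff_0 [simp]: "qcoeff 0 k = 0"
  by (simp add: qcoeff_def quaternion_eq_iff dual_number_eq_iff map_sels)

lemma qcoeff_1: "qcoeff 1 k = (if k = 0 then 1 else 0)"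
  by (simp add: qcoeff_def quaternion_eq_iff dual_number_eq_iff map_sels coeff_1)

lemma qcoeff_qconj: "qcoeff (qconj x) k = qconj (qcoeff x k)"
  by (simp add: qcoeff_def quaternion_eq_iff dual_number_eq_iff map_sels)

lemma qcoeff_qconst_mult: "qcoeff (qconst a * x) k = a * qcoeff x k"
  by (simp add: qcoeff_def qconst_def quaternion_eq_iff dual_number_eq_iff map_sels)

lemma qcoeff_qembed: "qcoeff (qembed c) k = of_real (coeff c k)"
  by (simp add: qcoeff_def qembed_def of_real_quat quaternion_eq_iff dual_number_eq_iff map_sels)

lemma qcoeff_mult: "qcoeff (x * y) k = (\<Sum>i\<le>k. qcoeff x i * qcoeff y (k - i))"
  by (simp add: qcoeff_def quaternion_eq_iff dual_number_eq_iff map_sels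
     quaternion_sum_sel dual_sum_sel
     coeff_mult sum.distrib sum_subtractf)

lemma quat_poly_eqI:
  assumes "\<And>k. qcoeff x k = qcoeff y k" shows "x = y"
  using assms by (simp add: qcoeff_def quaternion_eq_iff dual_number_eq_iff map_sels poly_eq_iff)

lemma qcoeff_eventually_0: "\<exists>n. \<forall>k>n. qcoeff x k = 0"
proof -
  have "\<exists>n. \<forall>k>n. coeff (p :: real poly) k = 0" for p
    using coeff_eq_0 by blast
  then obtain n where n: "\<And>p k. k > n p \<Longrightarrow> coeff (p :: real poly) k = 0" by metis
  let ?N = "Max (n ` {primal (qre x), primal (qi x), primal (qj x), primal (qk x),
     dualp (qre x), dualp (qi x), dualp (qj x), dualp (qk x)})"
  have "qcoeff x k = 0" if "k > ?N" for k
    using that by (simp add: qcoeff_def quaternion_eq_iff dual_number_eq_iff map_sels n)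
  then show ?thesis by blast
qed

lemma qembed_commute: "qembed c * x = x * qembed c"
  by (simp add: qembed_def quaternion_eq_iff dual_number_eq_iff algebra_simps)

text \<open>
  A real polynomial divides a quaternionic one exactly when it divides all eight components, so
  divisibility and coprimality arguments take place in the principal ideal domain
  \<open>\<real>[t]\<close>.
\<close>

lemma qembed_dvd_iff:
  "(\<exists>z. x = qembed c * z) \<longleftrightarrow>
    c dvd primal (qre x) \<and> c dvd primal (qi x) \<and> c dvd primal (qj x) \<and> c dvd primal (qk x) \<and>
    c dvd dualp (qre x) \<and> c dvd dualp (qi x) \<and> c dvd dualp (qj x) \<and> c dvd dualp (qk x)"
    (is "_ \<longleftrightarrow> ?R")
proof
  assume ?R
  then obtain a b d e a' b' d' e' where
    "primal (qre x) = c * a" "primal (qi x) = c * b" "primal (qj x) = c * d" "primal (qk x) = c * e"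
    "dualp (qre x) = c * a'" "dualp (qi x) = c * b'" "dualp (qj x) = c * d'" "dualp (qk x) = c * e'"
    unfolding dvd_def by blast
  then have "x = qembed c * Quat (Dual a a') (Dual b b') (Dual d d') (Dual e e')"
    by (simp add: qembed_def quaternion_eq_iff dual_number_eq_iff)
  then show "\<exists>z. x = qembed c * z" by blast
qed (auto simp: qembed_def)

lemma qembed_cancel: "x * qembed c = y * qembed c \<Longrightarrow> c \<noteq> 0 \<Longrightarrow> x = y"
  by (auto simp: qembed_def quaternion_eq_iff dual_number_eq_iff)

lemma qembed_dvd_coprime:
  assumes "qembed c * x = qembed d * y" "coprime c d"
  obtains z where "x = qembed d * z"
proof -
  have "\<exists>z. qembed c * x = qembed d * z" using assms by blast
  then have "\<exists>z. x = qembed d * z"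
    unfolding qembed_dvd_iff using coprime_dvd_mult_right_iff[of d c] assms(2)
    by (simp add: qembed_def coprime_commute)
  then show ?thesis using that by blast
qed

section \<open>Monic polynomials\<close>

definition monic_of_degree :: "nat \<Rightarrow> quat_poly \<Rightarrow> bool"
  where "monic_of_degree n x \<longleftrightarrow> qcoeff x n = 1 \<and> (\<forall>k>n. qcoeff x k = 0)"

lemma qcoeff_mult_top:
  assumes "\<And>k. k > m \<Longrightarrow> qcoeff x k = 0" "\<And>k. k > n \<Longrightarrow> qcoeff y k = 0"
  shows "qcoeff (x * y) (m + n) = qcoeff x m * qcoeff y n"
    and "k > m + n \<Longrightarrow> qcoeff (x * y) k = 0"
proof -
  have "qcoeff (x * y) (m + n) = (\<Sum>i\<in>{m}. qcoeff x i * qcoeff y (m + n - i))"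
    unfolding qcoeff_mult
  proof (rule sum.mono_neutral_right)
    show "\<forall>i\<in>{..m + n} - {m}. qcoeff x i * qcoeff y (m + n - i) = 0"
    proof
      fix i assume "i \<in> {..m + n} - {m}"
      then have "i > m \<or> m + n - i > n" by auto
      then show "qcoeff x i * qcoeff y (m + n - i) = 0" using assms by auto
    qed
  qed auto
  then show "qcoeff (x * y) (m + n) = qcoeff x m * qcoeff y n" by simp
  assume k: "k > m + n"
  show "qcoeff (x * y) k = 0" unfolding qcoeff_mult
  proof (rule sum.neutral, rule ballI)
    fix i assume "i \<in> {..k}"
    then have "i > m \<or> k - i > n" using k by auto
    then show "qcoeff x i * qcoeff y (k - i) = 0" using assms by auto
  qed
qed

lemma monic_mult:
  assumes "monic_of_degree m x" "monic_of_degree n y"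
  shows "monic_of_degree (m + n) (x * y)"
  using assms qcoeff_mult_top[of m x n y] by (auto simp: monic_of_degree_def)

text \<open>
  A monic right factor of a monic polynomial has a monic cofactor, although the coefficient ring
  has zero divisors: the product with a monic polynomial keeps the leading coefficient.
\<close>

lemma monic_left_factor:
  assumes "monic_of_degree (m + n) (x * y)" "monic_of_degree n y"
  shows "monic_of_degree m x"
proof -
  \<comment> \<open>The leading term of \<open>x\<close> survives in \<open>x * y\<close>, so it must be that of a monic polynomial.\<close>
  have "\<exists>k. qcoeff x k \<noteq> 0"
  proof (rule ccontr)
    assume "\<not> ?thesis"
    then have "x = 0" by (intro quat_poly_eqI) auto
    with assms(1) show False by (simp add: monic_of_degree_def)
  qed
  then obtain k0 where k0: "qcoeff x k0 \<noteq> 0" by blast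
  obtain b where b: "\<forall>k>b. qcoeff x k = 0" using qcoeff_eventually_0 by blast
  define d where "d = Max {k. qcoeff x k \<noteq> 0}"
  have fin: "finite {k. qcoeff x k \<noteq> 0}"
    by (rule finite_subset[of _ "{..b}"]) (use b in \<open>auto simp: not_le[symmetric]\<close>)
  have d: "qcoeff x d \<noteq> 0" using Max_in[OF fin] k0 by (auto simp: d_def)
  have above: "qcoeff x k = 0" if "k > d" for k
    using Max_ge[OF fin, of k] that by (auto simp: d_def)
  have top: "qcoeff (x * y) (d + n) = qcoeff x d" "\<And>k. k > d + n \<Longrightarrow> qcoeff (x * y) k = 0"
    using qcoeff_mult_top[of d x n y] above assms(2) by (auto simp: monic_of_degree_def)
  have "d + n = m + n"
    using top d assms(1) unfolding monic_of_degree_def by (metis linorder_neqE_nat zero_neq_one)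
  then show ?thesis
    using top above assms(1) unfolding monic_of_degree_def by simp
qed

lemma monic_0_iff: "monic_of_degree 0 x \<longleftrightarrow> x = 1"
proof
  assume "monic_of_degree 0 x"
  then show "x = 1" by (intro quat_poly_eqI) (auto simp: monic_of_degree_def qcoeff_1)
qed (auto simp: monic_of_degree_def qcoeff_1)

lemma monic_qconj: "monic_of_degree n x \<Longrightarrow> monic_of_degree n (qconj x)"
  by (simp add: monic_of_degree_def qcoeff_qconj)

lemma monic_qembed: "monic_of_degree n (qembed c) \<longleftrightarrow> degree c = n \<and> lead_coeff c = 1"
proof
  assume *: "monic_of_degree n (qembed c)"
  then have "coeff c n = 1" "\<forall>k>n. coeff c k = 0"
    by (auto simp: monic_of_degree_def qcoeff_qembed)
  moreover from this have "degree c = n"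
    by (metis degree_le le_degree order_antisym zero_neq_one)
  ultimately show "degree c = n \<and> lead_coeff c = 1" by simp
qed (auto simp: monic_of_degree_def qcoeff_qembed coeff_eq_0)

section \<open>Factorization of motion polynomials\<close>

lemma unit_if_primal_qnorm:
  fixes a :: dual_quat
  assumes "primal (qnorm a) \<noteq> 0"
  obtains u where "u * a = 1" "a * u = 1"
proof -
  define c where "c = primal (qnorm a)"
  \<comment> \<open>the inverse of the dual number \<open>qnorm a\<close>\<close>
  define d where "d = Dual (1 / c) (- dualp (qnorm a) / c\<^sup>2)"
  have d: "d * qnorm a = 1"
    using assms by (simp add: dual_number_eq_iff d_def c_def field_simps power2_eq_square)
  define u where "u = Quat d 0 0 0 * qconj a"
  have "u * a = Quat (d * qnorm a) 0 0 0"
    unfolding u_def mult.assoc qconj_mult_qnorm by (simp add: quaternion_eq_iff)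
  moreover have "a * u = Quat d 0 0 0 * (a * qconj a)"
    unfolding u_def by (simp add: quaternion_eq_iff algebra_simps)
  then have "a * u = Quat (d * qnorm a) 0 0 0"
    unfolding mult_qconj_qnorm by (simp add: quaternion_eq_iff)
  ultimately show ?thesis using that by (simp add: d one_quaternion_def)
qed

lemma qnorm_add_qembed_mult:
  "\<exists>w. qnorm (x + qembed c * z) = qnorm x + Dual c 0 * w"
proof
  show "qnorm (x + qembed c * z) = qnorm x + Dual c 0 *
    (2 * (qre x * qre z + qi x * qi z + qj x * qj z + qk x * qk z) + Dual c 0 * qnorm z)"
    by (simp add: qnorm_def qembed_def dual_number_eq_iff algebra_simps)
qed

text \<open>
  If the primal components of a remainder modulo the quadratic \<open>M\<close> have vanishing linear
  coefficients, which is what a zero sum of squares says, then they are constants. A nonzero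
  constant is not divisible by \<open>M\<close>, so the sum of their squares vanishes as well.
\<close>

lemma sum_four_squares_real_poly_eq_0:
  fixes a b c d :: "real poly"
  assumes "degree a < 2" "degree b < 2" "degree c < 2" "degree d < 2"
    and "M dvd a * a + b * b + c * c + d * d" "degree M = 2"
    and "(coeff a 1)\<^sup>2 + (coeff b 1)\<^sup>2 + (coeff c 1)\<^sup>2 + (coeff d 1)\<^sup>2 = 0"
  shows "a = 0 \<and> b = 0 \<and> c = 0 \<and> d = 0"
proof -
  have "coeff a 1 = 0" "coeff b 1 = 0" "coeff c 1 = 0" "coeff d 1 = 0"
    using assms(7) by (smt (verit) zero_le_power2 zero_less_power2)+
  then have "degree a = 0" "degree b = 0" "degree c = 0" "degree d = 0"
    using assms(1-4) by (metis One_nat_def leading_coeff_0_iff less_2_cases degree_0)+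
  then obtain a' b' c' d' where eq: "a = [:a':]" "b = [:b':]" "c = [:c':]" "d = [:d':]"
    by (metis degree_eq_zeroE)
  have "a * a + b * b + c * c + d * d = 0"
  proof (rule ccontr)
    assume "\<not> ?thesis"
    then have "degree M \<le> degree (a * a + b * b + c * c + d * d)"
      using assms(5) dvd_imp_degree_le by blast
    then show False using assms(6) by (simp add: eq)
  qed
  then have "a'\<^sup>2 + b'\<^sup>2 + c'\<^sup>2 + d'\<^sup>2 = 0" by (simp add: eq power2_eq_square)
  then have "a' = 0" "b' = 0" "c' = 0" "d' = 0"
    by (smt (verit) zero_le_power2 zero_less_power2)+
  then show ?thesis by (simp add: eq)
qed

text \<open>
  A finite set of monic irreducible real quadratics. Its elements are pairwise coprime because
  they are distinct; the multiplicity-freeness of a generic norm is thus built into the use of a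
  set.
\<close>

definition quadratic_factors :: "real poly set \<Rightarrow> bool"
  where "quadratic_factors S \<longleftrightarrow>
    finite S \<and> (\<forall>M\<in>S. lead_coeff M = 1 \<and> degree M = 2 \<and> irreducible M)"

text \<open>
  \<open>motion S P\<close>: \<open>P\<close> is a motion polynomial with norm the product of the quadratics in
  \<open>S\<close>, and of degree the number of these quadratics.
\<close>

definition motion :: "real poly set \<Rightarrow> quat_poly \<Rightarrow> bool"
  where "motion S P \<longleftrightarrow> monic_of_degree (card S) P \<and> qnorm P = Dual (\<Prod>S) 0"

lemma quadratic_factors_subset: "quadratic_factors S \<Longrightarrow> T \<subseteq> S \<Longrightarrow> quadratic_factors T"
  by (auto simp: quadratic_factors_def intro: finite_subset)

lemma prod_quadratic_factors:
  assumes "quadratic_factors S"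
  shows "lead_coeff (\<Prod>S) = 1" "degree (\<Prod>S) = 2 * card S" "\<Prod>S \<noteq> 0"
proof -
  show 1: "lead_coeff (\<Prod>S) = 1"
    unfolding lead_coeff_prod using assms
    by (intro prod.neutral) (auto simp: quadratic_factors_def)
  show "\<Prod>S \<noteq> 0" using 1 by auto
  have "degree (\<Prod>S) = (\<Sum>M\<in>S. degree M)"
    using assms by (intro degree_prod_eq_sum_degree) (auto simp: quadratic_factors_def)
  then show "degree (\<Prod>S) = 2 * card S"
    using assms by (simp add: quadratic_factors_def)
qed

lemma coprime_prod_quadratic_factors:
  assumes "quadratic_factors S" "A \<subseteq> S" "B \<subseteq> S" "A \<inter> B = {}"
  shows "coprime (\<Prod>A) (\<Prod>B)"
proof (intro prod_coprime_left prod_coprime_right)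
  fix M N assume *: "M \<in> A" "N \<in> B"
  have MN: "lead_coeff M = 1" "degree M = 2" "irreducible M"
     "lead_coeff N = 1" "degree N = 2" "irreducible N" "M \<noteq> N"
    using assms * by (auto simp: quadratic_factors_def)
  show "coprime M N"
  proof (rule prime_elem_imp_coprime)
    show "prime_elem M" using MN by (simp add: field_poly_irreducible_imp_prime)
    show "\<not> M dvd N"
    proof
      assume "M dvd N"
      then obtain c where c: "N = M * c" by blast
      then have "c \<noteq> 0" "M \<noteq> 0" using MN by auto
      then have "degree c = 0" using c MN by (simp add: degree_mult_eq)
      moreover have "lead_coeff c = 1" using c MN by (simp add: lead_coeff_mult)
      ultimately have "c = 1" by (metis degree_eq_zeroE lead_coeff_pCons(2) pCons_one)
      with c MN show False by simp
    qed
  qed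
qed

lemma motion_mult:
  assumes "motion S P" "motion T Q" "finite S" "finite T" "S \<inter> T = {}"
  shows "motion (S \<union> T) (P * Q)"
  using assms by (simp add: motion_def qnorm_mult card_Un_disjoint monic_mult
      prod.union_disjoint dual_number_eq_iff)

lemma motion_empty_iff: "motion {} P \<longleftrightarrow> P = 1"
  by (auto simp: motion_def monic_0_iff one_dual_number_def)

lemma motion_mult_qconj: "motion S P \<Longrightarrow> P * qconj P = qembed (\<Prod>S)"
  by (simp add: motion_def mult_qconj_qnorm qembed_def)

lemma motion_qconj_mult: "motion S P \<Longrightarrow> qconj P * P = qembed (\<Prod>S)"
  by (simp add: motion_def qconj_mult_qnorm qembed_def)

text \<open>
  The norm determines a right factor: if \<open>Q * A = Q' * B\<close> where \<open>A\<close> and \<open>B\<close> both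
  have norm \<open>N\<close>, then \<open>N\<close> divides \<open>(qconj Q * Q) * (A * qconj B)\<close>. The norm
  \<open>qconj Q * Q\<close>, the product of the remaining quadratics, is coprime to \<open>N\<close>. So \<open>N\<close>
  divides \<open>A * qconj B\<close>, which is monic of the same degree as \<open>N\<close>; hence \<open>A * qconj B = N = B * qconj B\<close>.
\<close>

lemma motion_right_factor_unique:
  assumes S: "quadratic_factors S" "T \<subseteq> S"
    and "Q * A = Q' * B" "motion (S - T) Q" "motion T A" "motion T B"
  shows "A = B"
proof -
  have "qembed (\<Prod>(S - T)) * (A * qconj B) = qconj Q * (Q * A) * qconj B"
    by (simp add: mult.assoc flip: motion_qconj_mult[OF assms(4)])
  also have "\<dots> = qembed (\<Prod>T) * (qconj Q * Q')"
    by (simp add: assms(3) mult.assoc motion_mult_qconj[OF assms(6)] qembed_commute)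
  finally obtain z where z: "A * qconj B = qembed (\<Prod>T) * z"
    using coprime_prod_quadratic_factors[of S "S - T" T] S
    by (elim qembed_dvd_coprime) auto
  have "monic_of_degree (0 + 2 * card T) (z * qembed (\<Prod>T))"
    using monic_mult[of "card T" A "card T" "qconj B"] assms(5,6) z
    by (simp add: motion_def monic_qconj qembed_commute mult_2)
  moreover have "monic_of_degree (2 * card T) (qembed (\<Prod>T))"
    using prod_quadratic_factors quadratic_factors_subset[OF S] by (simp add: monic_qembed)
  ultimately have "z = 1" using monic_left_factor monic_0_iff by blast
  then have "A * qconj B = B * qconj B"
    using z motion_mult_qconj[OF assms(6)] by simp
  then have "A * (qconj B * B) = B * (qconj B * B)" by (simp flip: mult.assoc)
  then show ?thesis
    unfolding motion_qconj_mult[OF assms(6)]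
    using qembed_cancel prod_quadratic_factors(3) quadratic_factors_subset[OF S] by blast
qed

text \<open>
  Every quadratic factor \<open>M\<close> of the norm belongs to a linear right factor of \<open>P\<close>. The
  remainder \<open>R\<close> of \<open>P\<close> modulo \<open>M\<close> has degree at most one and its norm is divisible by
  \<open>M\<close>. Its leading coefficient is a unit, since otherwise \<open>M\<close> would divide the primal part of
  \<open>P\<close> and \<open>M ^ 2\<close> the norm of \<open>P\<close>. Normalizing \<open>R\<close> to be monic gives \<open>L\<close> with norm \<open>M\<close>;
  as \<open>L\<close> right divides both \<open>M = qconj L * L\<close> and \<open>R\<close>, it right divides \<open>P\<close>.
\<close>

lemma motion_linear_factor:
  assumes S: "quadratic_factors S" and M: "M \<in> S" and P: "motion S P"
  obtains Q L where "P = Q * L" "motion (S - {M}) Q" "motion {M} L"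
proof -
  have M': "lead_coeff M = 1" "degree M = 2" and fin: "finite S" and "M \<noteq> 0"
    using S M by (auto simp: quadratic_factors_def)
  have prodS: "\<Prod>S = M * \<Prod>(S - {M})" using fin M by (rule prod.remove)
  define h where "h f = map_quaternion (map_dual_number f)" for f :: "real poly \<Rightarrow> real poly"
  define Q0 R where "Q0 = h (\<lambda>p. p div M) P" and "R = h (\<lambda>p. p mod M) P"
  have PR: "P = R + qembed M * Q0"
    by (simp add: R_def Q0_def h_def qembed_def quaternion_eq_iff dual_number_eq_iff map_sels)
  have degR: "degree (p mod M) < 2" for p
    using M' \<open>M \<noteq> 0\<close> degree_mod_less'[of M p] by (cases "p mod M = 0") auto
  have Rtop: "qcoeff R k = 0" if "k > 1" for k
    using coeff_eq_0[OF less_le_trans[OF degR], of k] that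
    by (simp add: qcoeff_def R_def h_def quaternion_eq_iff dual_number_eq_iff map_sels coeff_eq_0)
  obtain w where w: "qnorm P = qnorm R + Dual M 0 * w"
    using PR qnorm_add_qembed_mult by metis
  have normR: "qnorm R = Dual (\<Prod>S) 0 - Dual M 0 * w"
  proof -
    have "qnorm R = qnorm P - Dual M 0 * w" using w by simp
    then show ?thesis using P by (simp add: motion_def)
  qed
  have dvdR: "M dvd primal (qnorm R)" "M dvd dualp (qnorm R)"
    unfolding normR by (simp_all add: prodS)
  define a where "a = qcoeff R 1"
  have "primal (qnorm a) \<noteq> 0"
  proof
    assume 0: "primal (qnorm a) = 0"
    have "primal (qre R) = 0 \<and> primal (qi R) = 0 \<and> primal (qj R) = 0 \<and> primal (qk R) = 0"
    proof (rule sum_four_squares_real_poly_eq_0)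
      show "M dvd primal (qre R) * primal (qre R) + primal (qi R) * primal (qi R) +
          primal (qj R) * primal (qj R) + primal (qk R) * primal (qk R)"
        using dvdR(1) by (simp add: qnorm_def)
    qed (use 0 degR M' in \<open>simp_all add: R_def h_def a_def qnorm_def qcoeff_def map_sels power2_eq_square\<close>)
    then have "M dvd primal (qre P)" "M dvd primal (qi P)" "M dvd primal (qj P)" "M dvd primal (qk P)"
      by (simp_all add: R_def h_def map_sels mod_eq_0_iff_dvd)
    then have "M * M dvd primal (qnorm P)"
      unfolding qnorm_def by (auto intro!: dvd_add mult_dvd_mono)
    then have "M * M dvd M * \<Prod>(S - {M})" using P prodS by (simp add: motion_def)
    then have "M dvd \<Prod>(S - {M})" using \<open>M \<noteq> 0\<close> by simp
    moreover have "coprime (\<Prod>{M}) (\<Prod>(S - {M}))"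
      by (rule coprime_prod_quadratic_factors[OF S]) (use M in auto)
    ultimately have "is_unit M" by (simp add: coprime_absorb_left)
    then show False using M' \<open>M \<noteq> 0\<close> by (simp add: is_unit_iff_degree)
  qed
  then obtain u where u: "u * a = 1" "a * u = 1" by (rule unit_if_primal_qnorm)
  define L where "L = qconst u * R"
  have aL: "R = qconst a * L"
    by (simp add: L_def u(2) qconst_one flip: mult.assoc qconst_mult)
  have monL: "monic_of_degree 1 L"
    using u Rtop by (auto simp: monic_of_degree_def L_def qcoeff_qconst_mult a_def)
  have "M dvd primal (qnorm L)" "M dvd dualp (qnorm L)"
    using dvdR by (auto simp: L_def qnorm_mult)
  then have "\<exists>z. L * qconj L = qembed M * z"
    unfolding qembed_dvd_iff mult_qconj_qnorm by simp
  then obtain z where z: "L * qconj L = qembed M * z" by blast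
  \<comment> \<open>Comparing leading coefficients, the norm of \<open>L\<close> equals its divisor \<open>M\<close>.\<close>
  have "monic_of_degree (0 + 2) (z * qembed M)"
    using monic_mult[OF monL monic_qconj[OF monL]] z by (simp add: qembed_commute)
  then have "z = 1"
    using monic_left_factor[of 0 2 z "qembed M"] M' by (simp add: monic_qembed monic_0_iff)
  then have LL: "L * qconj L = qembed M" using z by simp
  have motL: "motion {M} L"
    using monL LL by (simp add: motion_def mult_qconj_qnorm qembed_def)
  define Q where "Q = Q0 * qconj L + qconst a"
  have PQ: "P = Q * L"
  proof -
    have "Q * L = Q0 * (qconj L * L) + qconst a * L"
      unfolding Q_def distrib_right mult.assoc ..
    also have "\<dots> = Q0 * qembed M + R" unfolding motion_qconj_mult[OF motL] aL[symmetric] by simp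
    finally show ?thesis using PR by (simp add: qembed_commute add.commute)
  qed
  have "card S = card (S - {M}) + 1" using card.remove[OF fin M] by simp
  then have "monic_of_degree (card (S - {M})) Q"
    using monic_left_factor[of _ 1 Q L] P PQ monL by (simp add: motion_def)
  moreover have "qnorm Q = Dual (\<Prod>(S - {M})) 0"
  proof -
    have "qnorm Q * Dual M 0 = Dual (M * \<Prod>(S - {M})) 0"
      using P motL prodS by (simp add: PQ motion_def qnorm_mult)
    then show ?thesis using \<open>M \<noteq> 0\<close> by (simp add: dual_number_eq_iff)
  qed
  ultimately have "motion (S - {M}) Q" by (simp add: motion_def)
  then show ?thesis using that PQ motL by blast
qed

lemma motion_right_factor:
  assumes S: "quadratic_factors S" and P: "motion S P" and "T \<subseteq> S"
  shows "\<exists>Q A. P = Q * A \<and> motion (S - T) Q \<and> motion T A"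
proof -
  have "finite T" using assms finite_subset by (auto simp: quadratic_factors_def)
  then show ?thesis using \<open>T \<subseteq> S\<close>
  proof (induction T)
    case empty
    then show ?case using P by (auto simp: motion_empty_iff)
  next
    case (insert M T)
    then obtain Q A where QA: "P = Q * A" "motion (S - T) Q" "motion T A" by auto
    obtain Q' L where QL: "Q = Q' * L" "motion (S - T - {M}) Q'" "motion {M} L"
      by (rule motion_linear_factor[OF quadratic_factors_subset[OF S] _ QA(2)])
        (use insert in auto)
    have "motion (insert M T) (L * A)"
      using motion_mult[OF QL(3) QA(3)] insert by simp
    moreover have "P = Q' * (L * A)" by (simp add: QA QL mult.assoc)
    moreover have "S - T - {M} = S - insert M T" by auto
    ultimately show ?case using QL(2) by metis
  qed
qed

text \<open>
  The right factor of \<open>P\<close> with norm the product of \<open>T\<close>, its cofactor having the complementary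
  norm. It exists uniquely if \<open>quadratic_factors S\<close>, \<open>motion S P\<close> and \<open>T \<subseteq> S\<close>.
\<close>

definition right_factor :: "real poly set \<Rightarrow> quat_poly \<Rightarrow> real poly set \<Rightarrow> quat_poly"
  where "right_factor S P T = (THE A. motion T A \<and> (\<exists>Q. motion (S - T) Q \<and> P = Q * A))"

lemma right_factor_eqI:
  assumes "quadratic_factors S" "T \<subseteq> S" "motion (S - T) Q" "motion T A" "P = Q * A"
  shows "right_factor S P T = A"
  unfolding right_factor_def using motion_right_factor_unique[OF assms(1,2)] assms
  by (intro the_equality) metis+

lemma right_factor:
  assumes "quadratic_factors S" "motion S P" "T \<subseteq> S"
  shows "motion T (right_factor S P T)"
    "\<exists>Q. motion (S - T) Q \<and> P = Q * right_factor S P T"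
  using motion_right_factor[OF assms] right_factor_eqI[OF assms(1,3)] by metis+

lemma right_factor_empty:
  assumes "quadratic_factors S" "motion S P"
  shows "right_factor S P {} = 1"
  using right_factor(1)[OF assms, of "{}"] by (simp add: motion_empty_iff)

lemma right_factor_full:
  assumes "quadratic_factors S" "motion S P"
  shows "right_factor S P S = P"
  using right_factor_eqI[OF assms(1), of S 1 P P] assms(2) by (simp add: motion_empty_iff)

text \<open>
  The right factors form a cube: those belonging to \<open>T\<close> and to \<open>T - {M}\<close> differ by a
  linear left factor.
\<close>

lemma right_factor_step:
  assumes S: "quadratic_factors S" and P: "motion S P" and "T \<subseteq> S" "M \<in> T"
  obtains L where "motion {M} L" "right_factor S P T = L * right_factor S P (T - {M})"
proof -
  note T = quadratic_factors_subset[OF S \<open>T \<subseteq> S\<close>]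
  have fin: "finite S" "finite T" using S T by (auto simp: quadratic_factors_def)
  obtain Q where Q: "motion (S - T) Q" "P = Q * right_factor S P T"
    using right_factor(2)[OF S P \<open>T \<subseteq> S\<close>] by blast
  obtain L B where LB: "right_factor S P T = L * B" "motion (T - (T - {M})) L" "motion (T - {M}) B"
    using motion_right_factor[OF T right_factor(1)[OF S P \<open>T \<subseteq> S\<close>], of "T - {M}"] by blast
  have L: "motion {M} L" using LB(2) \<open>M \<in> T\<close> by (simp add: Diff_Diff_Int)
  have "motion ((S - T) \<union> {M}) (Q * L)"
    using motion_mult[OF Q(1) L] fin \<open>M \<in> T\<close> by simp
  moreover have "(S - T) \<union> {M} = S - (T - {M})" using assms(3,4) by auto
  ultimately have "motion (S - (T - {M})) (Q * L)" by simp
  then have "right_factor S P (T - {M}) = B"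
    using Q(2) LB(1,3) assms(3) by (intro right_factor_eqI[OF S]) (auto simp: mult.assoc)
  then show ?thesis using that L LB(1) by simp
qed

section \<open>Evaluation and induced maps\<close>

lemma qeval_eq_sum:
  assumes "\<forall>k>n. qcoeff x k = 0"
  shows "qeval t x = (\<Sum>i\<le>n. t ^ i *\<^sub>R qcoeff x i)"
proof -
  have "poly p t = (\<Sum>i\<le>n. t ^ i * coeff p i)" if "\<forall>k>n. coeff p k = 0" for p
  proof -
    have "degree p \<le> n" using that by (simp add: degree_le)
    then show ?thesis
      unfolding poly_altdef using coeff_eq_0[of p]
      by (intro sum.mono_neutral_cong_left) (auto simp: mult.commute)
  qed
  then show ?thesis using assms
    by (simp add: qeval_def qcoeff_def quaternion_eq_iff dual_number_eq_iff map_sels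
        quaternion_sum_sel dual_sum_sel)
qed

text \<open>
  The polynomial with dual quaternion coefficients corresponding to an element of
  \<open>quat_poly\<close>; by \<open>quat_poly_eqI\<close> and \<open>ex_of_quat_poly\<close> this is a bijection.
\<close>

definition of_quat_poly :: "quat_poly \<Rightarrow> dual_quat poly"
  where "of_quat_poly x = Abs_poly (qcoeff x)"

lemma coeff_of_quat_poly: "coeff (of_quat_poly x) k = qcoeff x k"
proof -
  obtain n where "\<forall>k>n. qcoeff x k = 0" using qcoeff_eventually_0 by blast
  then show ?thesis unfolding of_quat_poly_def by (subst coeff_Abs_poly[of n]) auto
qed

lemma poly_at_of_quat_poly: "poly_at (of_quat_poly x) t = qeval t x"
  unfolding poly_at_def
  by (subst qeval_eq_sum[of "degree (of_quat_poly x)"])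
    (auto simp: coeff_eq_0 simp flip: coeff_of_quat_poly)

lemma lead_coeff_of_quat_poly:
  assumes "monic_of_degree n x"
  shows "lead_coeff (of_quat_poly x) = 1"
proof -
  have "degree (of_quat_poly x) = n"
    using assms coeff_of_quat_poly unfolding monic_of_degree_def
    by (metis degree_le le_degree order_antisym zero_neq_one)
  then show ?thesis using assms by (simp add: coeff_of_quat_poly monic_of_degree_def)
qed

lemma ex_of_quat_poly: "\<exists>x. of_quat_poly x = P"
proof
  let ?p = "\<lambda>f g. map_poly (\<lambda>a. f (g a)) P"
  show "of_quat_poly (Quat (Dual (?p primal qre) (?p dualp qre)) (Dual (?p primal qi) (?p dualp qi))
      (Dual (?p primal qj) (?p dualp qj)) (Dual (?p primal qk) (?p dualp qk))) = P"
    by (intro poly_eqI)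
      (simp add: coeff_of_quat_poly qcoeff_def coeff_map_poly quaternion_eq_iff dual_number_eq_iff)
qed

lemma motion_polynomial_imp_motion:
  assumes "lead_coeff (of_quat_poly x) = 1"
    and "poly_prod (of_quat_poly x) (map_poly qconj (of_quat_poly x)) = map_poly of_real (\<Prod>S)"
    and "card S = degree (of_quat_poly x)"
  shows "motion S x"
proof -
  have "qcoeff (x * qconj x) k = qcoeff (qembed (\<Prod>S)) k" for k
  proof -
    have "coeff (poly_prod (of_quat_poly x) (map_poly qconj (of_quat_poly x))) k =
        qcoeff (x * qconj x) k"
      by (simp add: coeff_poly_prod coeff_map_poly coeff_of_quat_poly qcoeff_mult qcoeff_qconj)
    then show ?thesis by (simp add: assms(2) coeff_map_poly qcoeff_qembed)
  qed
  then have "x * qconj x = qembed (\<Prod>S)" by (rule quat_poly_eqI)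
  then have "qnorm x = Dual (\<Prod>S) 0" by (simp add: mult_qconj_qnorm qembed_def)
  moreover have "monic_of_degree (card S) x"
    using assms(1,3) by (simp add: monic_of_degree_def coeff_eq_0 flip: coeff_of_quat_poly)
  ultimately show ?thesis by (simp add: motion_def)
qed

section \<open>Linear motion polynomials and rotations\<close>

lemma irreducible_quadratic_no_root:
  fixes M :: "'a::field poly"
  assumes "irreducible M" "degree M = 2"
  shows "poly M r \<noteq> 0"
proof
  assume "poly M r = 0"
  then obtain c where c: "M = [:- r, 1:] * c" by (auto simp: poly_eq_0_iff_dvd)
  then have "c \<noteq> 0" using assms(2) by auto
  then have "degree c = 1" using c assms(2) by (simp add: degree_mult_eq del: mult_pCons_left)
  with c assms(1) \<open>c \<noteq> 0\<close> show False
    by (auto simp: is_unit_iff_degree dest: irreducibleD simp del: mult_pCons_left)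
qed

lemma qnorm_real: "h * qconj h \<in> \<real> \<longleftrightarrow> dualp (qnorm h) = 0" for h :: dual_quat
  by (auto simp: mult_qconj_qnorm Reals_def of_real_quat quaternion_eq_iff dual_number_eq_iff
      image_iff)

lemma qnorm_eval_motion:
  assumes "motion S x"
  shows "qnorm (qeval t x) = Dual (poly (\<Prod>S) t) 0"
  using assms by (simp add: motion_def qnorm_qeval)

text \<open>
  A linear motion polynomial with irreducible norm is \<open>t - h\<close> for a rotation quaternion
  \<open>h\<close>. If the primal part of \<open>h\<close> were a real number, that number would be a root of the norm.
\<close>

lemma motion_linear_rotation:
  assumes "motion {M} L" "irreducible M" "degree M = 2"
  shows "\<exists>h. rotation_quaternion h \<and> (\<forall>t. qeval t L = of_real t - h)"
proof -
  define h where "h = - qcoeff L 0"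
  have ev: "qeval t L = of_real t - h" for t
    using assms(1) by (subst qeval_eq_sum[of 1]) (auto simp: motion_def monic_of_degree_def h_def of_real_def)
  have norm: "qnorm (of_real t - h) = Dual (poly M t) 0" for t
    using qnorm_eval_motion[OF assms(1), of t] by (simp add: ev)
  have "dualp (qnorm h) = 0"
    using norm[of 0] by (simp add: qnorm_def dual_number_eq_iff)
  moreover have "dualp (qre h) = 0"
    using norm[of 0] norm[of 1] by (simp add: qnorm_def dual_number_eq_iff algebra_simps)
  then have "h + qconj h = of_real (2 * primal (qre h))"
    by (simp add: of_real_quat quaternion_eq_iff dual_number_eq_iff del: of_real_mult)
  then have "h + qconj h \<in> \<real>" by (metis Reals_of_real)
  moreover have prim: "primal_part h \<notin> \<real>"
  proof
    assume "primal_part h \<in> \<real>"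
    then obtain r where r: "primal_part h = of_real r" by (auto elim: Reals_cases)
    then have "primal (qre h) = r" "primal (qi h) = 0" "primal (qj h) = 0" "primal (qk h) = 0"
      by (simp_all add: quaternion_eq_iff of_real_def map_sels)
    then have "poly M r = 0"
      using norm[of r] by (simp add: qnorm_def dual_number_eq_iff of_real_quat)
    then show False using irreducible_quadratic_no_root[OF assms(2,3)] by blast
  qed
  moreover have "h \<noteq> 0" using prim by auto
  ultimately show ?thesis using ev by (auto simp: rotation_quaternion_def qnorm_real)
qed

lemma study_group_inv:
  assumes "x * qconj x \<in> \<real>" "primal_part x \<noteq> 0"
  shows "inv\<^bsub>study_group\<^esub> (proj x) = proj (qconj x)"
proof -
  interpret group study_group by (rule group_study_group)
  obtain r where r: "r \<noteq> 0" "x * qconj x = of_real r" using mult_qconj_real_nz assms by metis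
  then have r': "qconj x * qconj (qconj x) = of_real r" by (simp add: mult_qconj_commute)
  show ?thesis
  proof (rule inv_equality)
    show "proj (qconj x) \<otimes>\<^bsub>study_group\<^esub> proj x = \<one>\<^bsub>study_group\<^esub>"
      using r r' by (simp add: study_group_mult study_group_one of_real_def proj_scaleR)
    show "proj (qconj x) \<in> carrier study_group"
      unfolding proj_in_carrier using r' mult_qconj_real_nzD[OF r' r(1)] by auto
  qed (use assms in \<open>simp add: proj_in_carrier\<close>)
qed

text \<open>
  Since \<open>q = h + qconj h\<close> is real, \<open>s - qconj h = - ((q - s) - h)\<close>: inversion acts on the
  parameter of the rotation subgroup by \<open>s \<mapsto> q - s\<close>.
\<close>

lemma rotation_subgroup_inv:
  assumes h: "rotation_quaternion h" and X: "X \<in> rotation_subgroup h"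
  shows "inv\<^bsub>study_group\<^esub> X \<in> rotation_subgroup h"
proof -
  interpret group study_group by (rule group_study_group)
  obtain t :: "real option" where t: "X = (case t of None \<Rightarrow> proj 1 | Some s \<Rightarrow> proj (of_real s - h))"
    using X by (auto simp: rotation_subgroup_def)
  show ?thesis
  proof (cases t)
    case None
    then have "inv\<^bsub>study_group\<^esub> X = proj 1"
      using t inv_one by (simp add: study_group_one)
    then show ?thesis
      unfolding rotation_subgroup_def by (intro range_eqI[of _ _ None]) simp
  next
    case (Some s)
    let ?x = "of_real s - h"
    obtain q where q: "h + qconj h = of_real q"
      using h by (auto simp: rotation_quaternion_def elim: Reals_cases)
    have "primal_part ?x = of_real s - primal_part h"
      by (simp add: quaternion_eq_iff map_sels of_real_quat) (simp add: of_real_def)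
    then have x: "primal_part ?x \<noteq> 0"
      using h by (metis Reals_of_real eq_iff_diff_eq_0 rotation_quaternion_def)
    have "dualp (qre h) = 0"
      using q by (auto simp: quaternion_eq_iff of_real_quat dual_number_eq_iff)
    moreover have "dualp (qnorm h) = 0" using h by (simp add: rotation_quaternion_def qnorm_real)
    ultimately have "?x * qconj ?x \<in> \<real>"
      unfolding qnorm_real by (simp add: qnorm_def of_real_quat algebra_simps)
    then have "inv\<^bsub>study_group\<^esub> X = proj (qconj ?x)"
      using study_group_inv x t Some by simp
    also have "qconj ?x = (- 1) *\<^sub>R (of_real (q - s) - h)"
    proof -
      have "qconj ?x = of_real s - qconj h"
        by (simp add: quaternion_eq_iff of_real_quat)
      also have "qconj h = of_real q - h" using q by (simp add: algebra_simps)
      finally show ?thesis by simp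
    qed
    also have "proj \<dots> = proj (of_real (q - s) - h)" by (rule proj_scaleR) simp
    finally show ?thesis
      unfolding rotation_subgroup_def by (intro range_eqI[of _ _ "Some (q - s)"]) simp
  qed
qed

lemma proj_quotient:
  assumes "a * qconj a \<in> \<real>" "primal_part a \<noteq> 0"
  shows "proj (b * a) \<otimes>\<^bsub>study_group\<^esub> inv\<^bsub>study_group\<^esub> (proj a) = proj b"
proof -
  obtain r where r: "r \<noteq> 0" "a * qconj a = of_real r" using mult_qconj_real_nz assms by metis
  then have "b * a * qconj a = r *\<^sub>R b" by (simp add: mult.assoc of_real_def)
  then show ?thesis
    using r by (simp add: study_group_inv[OF assms] study_group_mult proj_scaleR)
qed

section \<open>Poses of the links\<close>

lemma motion_pose:
  assumes "quadratic_factors S" "motion S x"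
  shows "qeval t x * qconj (qeval t x) \<in> \<real>" "primal_part (qeval t x) \<noteq> 0"
proof -
  have n: "qnorm (qeval t x) = Dual (poly (\<Prod>S) t) 0" by (rule qnorm_eval_motion[OF assms(2)])
  then show "qeval t x * qconj (qeval t x) \<in> \<real>" by (simp add: qnorm_real)
  have "poly (\<Prod>S) t \<noteq> 0"
    using assms(1) irreducible_quadratic_no_root by (auto simp: poly_prod quadratic_factors_def)
  moreover have "qeval t x * qconj (qeval t x) = of_real (poly (\<Prod>S) t)"
    by (simp add: mult_qconj_qnorm n of_real_quat)
  ultimately show "primal_part (qeval t x) \<noteq> 0" by (intro mult_qconj_real_nzD)
qed

lemma motion_induced_map:
  assumes "motion S x"
  shows "induced_map (of_quat_poly x) t =
    (case t of None \<Rightarrow> proj 1 | Some s \<Rightarrow> proj (qeval s x))"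
  using assms lead_coeff_of_quat_poly
  by (auto simp: induced_map_def motion_def poly_at_of_quat_poly split: option.split)

lemma motion_induced_map_carrier:
  assumes "quadratic_factors S" "motion S x"
  shows "induced_map (of_quat_poly x) t \<in> carrier study_group"
proof -
  interpret group study_group by (rule group_study_group)
  have "proj 1 \<in> carrier study_group" using one_closed by (simp add: study_group_one)
  then show ?thesis
    using motion_pose[OF assms] by (auto simp: motion_induced_map[OF assms(2)] proj_in_carrier split: option.split)
qed

lemma motion_induced_map_quotient:
  assumes S: "quadratic_factors S" "M \<in> S" and x: "motion (S - {M}) x" and L: "motion {M} L"
  obtains h where "rotation_quaternion h"
    "\<And>t. induced_map (of_quat_poly (L * x)) t \<otimes>\<^bsub>study_group\<^esub>
        inv\<^bsub>study_group\<^esub> (induced_map (of_quat_poly x) t) \<in> rotation_subgroup h"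
proof -
  interpret group study_group by (rule group_study_group)
  have S': "quadratic_factors (S - {M})" "quadratic_factors {M}"
    using S quadratic_factors_subset by blast+
  have Lx: "motion ({M} \<union> (S - {M})) (L * x)"
    using motion_mult[OF L x] S by (auto simp: quadratic_factors_def)
  obtain h where h: "rotation_quaternion h" "\<And>t. qeval t L = of_real t - h"
    using motion_linear_rotation[OF L] S by (auto simp: quadratic_factors_def)
  have "induced_map (of_quat_poly (L * x)) t \<otimes>\<^bsub>study_group\<^esub>
        inv\<^bsub>study_group\<^esub> (induced_map (of_quat_poly x) t) =
        (case t of None \<Rightarrow> proj 1 | Some s \<Rightarrow> proj (of_real s - h))" for t
    unfolding motion_induced_map[OF Lx] motion_induced_map[OF x]
    using inv_one proj_quotient[OF motion_pose[OF S'(1) x]]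
    by (auto simp: study_group_one[symmetric] qeval_mult h(2) split: option.split)
  then show ?thesis using that[OF h(1)] by (auto simp: rotation_subgroup_def)
qed

section \<open>The edges of the hypercube\<close>

text \<open>
  Edges of the cube directed upwards: \<open>(i, u)\<close> stands for the edge from \<open>u\<close>, with
  \<open>u i = 0\<close>, to \<open>u(i := 1)\<close>.
\<close>

definition cube_arrows :: "nat \<Rightarrow> (nat \<times> (nat \<Rightarrow> nat)) set"
  where "cube_arrows n = (SIGMA i:{..<n}. {u \<in> cube_vertices n. u i = 0})"

lemma card_cube_vertices: "card (cube_vertices n) = 2 ^ n"
proof -
  have "card {0, 1 :: nat} = 2" by simp
  then show ?thesis unfolding cube_vertices_def card_PiE[OF finite_lessThan]
    by (simp add: numeral_2_eq_2)
qed

lemma cube_vertex_cases: "u \<in> cube_vertices n \<Longrightarrow> i < n \<Longrightarrow> u i = 0 \<or> u i = 1"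
  unfolding cube_vertices_def by (drule PiE_mem) auto

lemma cube_vertices_upd:
  "u \<in> cube_vertices n \<Longrightarrow> i < n \<Longrightarrow> c \<in> {0, 1} \<Longrightarrow> u(i := c) \<in> cube_vertices n"
  by (auto simp: cube_vertices_def PiE_iff extensional_def)

lemma cube_vertices_eqI:
  assumes "u \<in> cube_vertices n" "v \<in> cube_vertices n" "\<And>j. j < n \<Longrightarrow> u j = v j"
  shows "u = v"
  using assms unfolding cube_vertices_def by (intro PiE_ext) auto

lemma card_cube_arrows: "finite (cube_arrows n)" "card (cube_arrows n) = n * 2 ^ (n - 1)"
proof -
  have eq: "{u \<in> cube_vertices n. u i = 0} = (\<Pi>\<^sub>E j\<in>{..<n}. if j = i then {0} else {0, 1})"
    if "i < n" for i
  proof (intro equalityI subsetI)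
    fix u assume "u \<in> {u \<in> cube_vertices n. u i = 0}"
    then show "u \<in> (\<Pi>\<^sub>E j\<in>{..<n}. if j = i then {0} else {0, 1})"
      by (auto simp: cube_vertices_def PiE_iff)
  next
    fix u :: "nat \<Rightarrow> nat"
    assume u: "u \<in> (\<Pi>\<^sub>E j\<in>{..<n}. if j = i then {0} else {0, 1})"
    then have "u j \<in> {0, 1}" if "j < n" for j
      using PiE_mem[OF u, of j] that by (auto split: if_splits)
    moreover have "u i = 0" using PiE_mem[OF u, of i] that by simp
    ultimately show "u \<in> {u \<in> cube_vertices n. u i = 0}"
      using u by (simp add: cube_vertices_def PiE_iff)
  qed
  have fin: "finite (cube_vertices n)" by (simp add: cube_vertices_def finite_PiE)
  show "finite (cube_arrows n)" using fin by (simp add: cube_arrows_def)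
  have "card {u \<in> cube_vertices n. u i = 0} = 2 ^ (n - 1)" if "i < n" for i
  proof -
    have "card {u \<in> cube_vertices n. u i = 0} = (\<Prod>j<n. if j = i then 1 else 2)"
      unfolding eq[OF that] card_PiE[OF finite_lessThan] by (intro prod.cong) auto
    also have "\<dots> = (\<Prod>j\<in>{..<n} - {i}. 2)"
      using that by (subst prod.remove[of _ i]) (auto intro!: prod.cong)
    finally show ?thesis using that by simp
  qed
  then show "card (cube_arrows n) = n * 2 ^ (n - 1)"
    using fin by (simp add: cube_arrows_def card_SigmaI)
qed

lemma bij_betw_cube_arrows_edges:
  "bij_betw (\<lambda>(i, u). {u, u(i := 1)}) (cube_arrows n) (cube_edges n)"
proof (rule bij_betw_imageI)
  show "inj_on (\<lambda>(i, u). {u, u(i := 1)}) (cube_arrows n)"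
  proof (rule inj_onI, clarify)
    fix i u j v
    assume a: "(i, u) \<in> cube_arrows n" "(j, v) \<in> cube_arrows n"
      and eq: "{u, u(i := 1)} = {v, v(j := 1)}"
    have 0: "u i = 0" "v j = 0" using a by (auto simp: cube_arrows_def)
    from eq consider "u = v" "u(i := 1) = v(j := 1)" | "u = v(j := 1)" "u(i := 1) = v"
      by (auto simp: doubleton_eq_iff)
    then show "i = j \<and> u = v"
    proof cases
      case 1
      then have "(u(i := 1)) i = (v(j := 1)) i" by simp
      then show ?thesis using 0 1 by (auto split: if_splits)
    next
      case 2
      from 2(2) have "v i = 1" by (metis fun_upd_same)
      moreover from 2(1) have "u i = (if i = j then 1 else v i)" by simp
      ultimately show ?thesis using 0 by (simp split: if_splits)
    qed
  qed
  show "(\<lambda>(i, u). {u, u(i := 1)}) ` cube_arrows n = cube_edges n"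
  proof (intro equalityI subsetI)
    fix e assume "e \<in> (\<lambda>(i, u). {u, u(i := 1)}) ` cube_arrows n"
    then obtain i u where iu: "i < n" "u \<in> cube_vertices n" "u i = 0" "e = {u, u(i := 1)}"
      by (auto simp: cube_arrows_def)
    moreover have "\<exists>!k. k < n \<and> u k \<noteq> (u(i := 1)) k"
      using iu by (intro ex1I[of _ i]) (auto split: if_splits)
    ultimately show "e \<in> cube_edges n"
      using cube_vertices_upd[of u n i 1] unfolding cube_edges_def by blast
  next
    fix e assume "e \<in> cube_edges n"
    then obtain u v where e: "e = {u, v}" "u \<in> cube_vertices n" "v \<in> cube_vertices n"
      and ex: "\<exists>!i. i < n \<and> u i \<noteq> v i" by (auto simp: cube_edges_def)
    have up: "{u, v} \<in> (\<lambda>(i, u). {u, u(i := 1)}) ` cube_arrows n"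
      if "u \<in> cube_vertices n" "v \<in> cube_vertices n" "i < n" "u i = 0" "v i = 1"
        "\<And>j. j < n \<Longrightarrow> j \<noteq> i \<Longrightarrow> u j = v j" for u v i
    proof -
      have "v = u(i := 1)"
        using that cube_vertices_upd[of u n i 1] by (intro cube_vertices_eqI) auto
      then show ?thesis
        using that by (intro image_eqI[of _ _ "(i, u)"]) (auto simp: cube_arrows_def)
    qed
    obtain i where i: "i < n" "u i \<noteq> v i" "\<And>j. j < n \<Longrightarrow> j \<noteq> i \<Longrightarrow> u j = v j"
      using ex by metis
    have "u i = 0 \<and> v i = 1 \<or> v i = 0 \<and> u i = 1"
      using cube_vertex_cases e(2,3) i(1,2) by metis
    then show "e \<in> (\<lambda>(i, u). {u, u(i := 1)}) ` cube_arrows n"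
      using up[of u v i] up[of v u i] e i by (metis insert_commute)
  qed
qed

section \<open>The mechanism\<close>

text \<open>
  A family of poses in the group, indexed by the vertices of the cube and constantly the identity
  at one of them, is a motion of a mechanism on the 1-skeleton as soon as the relative poses along
  the upward edges lie in fixed rotation subgroups. Links and
  joints are numbered arbitrarily; the two orientations of a joint are interchanged by inversion
  in the rotation subgroup.
\<close>

lemma hypercube_mechanism:
  fixes F :: "(nat \<Rightarrow> nat) \<Rightarrow> dual_quat poly" and h :: "nat \<times> (nat \<Rightarrow> nat) \<Rightarrow> dual_quat"
  assumes rot: "\<And>a. a \<in> cube_arrows n \<Longrightarrow> rotation_quaternion (h a)"
    and carrier: "\<And>u t. u \<in> cube_vertices n \<Longrightarrow> induced_map (F u) t \<in> carrier study_group"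
    and base: "u0 \<in> cube_vertices n" "\<And>t. induced_map (F u0) t = \<one>\<^bsub>study_group\<^esub>"
    and step: "\<And>i u t. (i, u) \<in> cube_arrows n \<Longrightarrow>
      induced_map (F (u(i := 1))) t \<otimes>\<^bsub>study_group\<^esub> inv\<^bsub>study_group\<^esub> (induced_map (F u) t)
        \<in> rotation_subgroup (h (i, u))"
    and top: "u1 \<in> cube_vertices n"
  shows "\<exists>M :: (nat, nat) mechanism.
    revolute_mechanism M \<and>
    card (links M) = 2 ^ n \<and>
    card (joints M) = n * 2 ^ (n - 1) \<and>
    link_graph_is_hypercube n M \<and>
    (\<exists>L\<in>links M. contained_in_motion (range (induced_map (F u1))) M L)"
proof -
  interpret group study_group by (rule group_study_group)
  have "finite (cube_vertices n)" by (simp add: cube_vertices_def finite_PiE)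
  then obtain g :: "nat \<Rightarrow> nat \<Rightarrow> nat" where g: "bij_betw g {0..<2 ^ n} (cube_vertices n)"
    using ex_bij_betw_nat_finite[of "cube_vertices n"] by (auto simp: card_cube_vertices)
  obtain k where k: "bij_betw k {0..<n * 2 ^ (n - 1)} (cube_arrows n)"
    using ex_bij_betw_nat_finite[of "cube_arrows n"] by (auto simp: card_cube_arrows)
  define g' where "g' = inv_into {0..<2 ^ n} g"
  have g': "g' u \<in> {0..<2 ^ n}" "g (g' u) = u" if "u \<in> cube_vertices n" for u
    using bij_betwE[OF bij_betw_inv_into[OF g]] bij_betw_inv_into_right[OF g] that
    by (auto simp: g'_def)
  define M :: "(nat, nat) mechanism" where
    "M = \<lparr> links = {0..<2 ^ n}, base = g' u0, joints = {0..<n * 2 ^ (n - 1)},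
       ends = (\<lambda>J. g' ` (case k J of (i, u) \<Rightarrow> {u, u(i := 1)})),
       joint_quat = (\<lambda>J. h (k J)) \<rparr>"
  have joint: "\<exists>i u. k J = (i, u) \<and> (i, u) \<in> cube_arrows n \<and> u \<in> cube_vertices n \<and>
      u(i := 1) \<in> cube_vertices n \<and> u i = 0 \<and> ends M J = {g' u, g' (u(i := 1))} \<and>
      joint_quat M J = h (i, u)" if "J \<in> joints M" for J
  proof -
    obtain i u where iu: "k J = (i, u)" by force
    have "k J \<in> cube_arrows n" using bij_betwE[OF k] that by (simp add: M_def)
    then have "(i, u) \<in> cube_arrows n" by (simp add: iu)
    then show ?thesis using iu cube_vertices_upd[of u n i 1] by (auto simp: M_def cube_arrows_def)
  qed
  have "revolute_mechanism M"
    unfolding revolute_mechanism_def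
  proof (intro conjI ballI)
    fix J assume "J \<in> joints M"
    from joint[OF this] obtain i u where J: "(i, u) \<in> cube_arrows n" "u \<in> cube_vertices n"
      "u(i := 1) \<in> cube_vertices n" "u i = 0" "ends M J = {g' u, g' (u(i := 1))}"
      "joint_quat M J = h (i, u)" by blast
    show "rotation_quaternion (joint_quat M J)" using J rot by simp
    show "ends M J \<subseteq> links M" using J g'(1) by (simp add: M_def)
    have "u \<noteq> u(i := 1)" using J(4) by (metis fun_upd_same zero_neq_one)
    then have "g' u \<noteq> g' (u(i := 1))" using g'(2) J(2,3) by metis
    then show "card (ends M J) = 2" using J by simp
  qed (use base(1) g' in \<open>simp_all add: M_def\<close>)
  moreover have "link_graph_is_hypercube n M"
    unfolding link_graph_is_hypercube_def
  proof (intro exI conjI)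
    show "bij_betw g (links M) (cube_vertices n)" using g by (simp add: M_def)
    have bij: "bij_betw ((\<lambda>(i, u). {u, u(i := 1)}) \<circ> k) (joints M) (cube_edges n)"
      using bij_betw_trans[OF k bij_betw_cube_arrows_edges] by (simp add: M_def)
    show "bij_betw (\<lambda>J. g ` ends M J) (joints M) (cube_edges n)"
    proof (rule iffD1[OF bij_betw_cong bij])
      fix J assume "J \<in> joints M"
      from joint[OF this] show "((\<lambda>(i, u). {u, u(i := 1)}) \<circ> k) J = g ` ends M J"
        using g'(2) by auto
    qed
  qed
  moreover have "contained_in_motion (range (induced_map (F u1))) M (g' u1)"
    unfolding contained_in_motion_def
  proof (intro exI conjI ballI allI)
    let ?\<phi> = "\<lambda>L. induced_map (F (g L))"
    fix t
    show "configuration M (\<lambda>L. ?\<phi> L t)"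
      unfolding configuration_def
    proof (intro conjI ballI allI impI)
      fix L assume "L \<in> links M"
      then show "?\<phi> L t \<in> carrier study_group"
        using carrier bij_betwE[OF g] by (simp add: M_def)
    next
      show "?\<phi> (base M) t = \<one>\<^bsub>study_group\<^esub>" using base g' by (simp add: M_def)
    next
      fix J L1 L2 assume "J \<in> joints M" and ends: "ends M J = {L1, L2}"
      from joint[OF this(1)] obtain i u where J: "(i, u) \<in> cube_arrows n" "u \<in> cube_vertices n"
        "u(i := 1) \<in> cube_vertices n" "ends M J = {g' u, g' (u(i := 1))}"
        "joint_quat M J = h (i, u)" by blast
      let ?a = "induced_map (F u) t" and ?b = "induced_map (F (u(i := 1))) t"
      have ab: "?a \<in> carrier study_group" "?b \<in> carrier study_group" using carrier J by auto
      have fwd: "?b \<otimes>\<^bsub>study_group\<^esub> inv\<^bsub>study_group\<^esub> ?a \<in> rotation_subgroup (h (i, u))"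
        using step J by blast
      have "?a \<otimes>\<^bsub>study_group\<^esub> inv\<^bsub>study_group\<^esub> ?b =
          inv\<^bsub>study_group\<^esub> (?b \<otimes>\<^bsub>study_group\<^esub> inv\<^bsub>study_group\<^esub> ?a)"
        using ab by (simp add: inv_mult_group)
      then have bwd: "?a \<otimes>\<^bsub>study_group\<^esub> inv\<^bsub>study_group\<^esub> ?b \<in> rotation_subgroup (h (i, u))"
        using rotation_subgroup_inv[OF rot[OF J(1)] fwd] by simp
      from ends J(4) have "L1 = g' u \<and> L2 = g' (u(i := 1)) \<or> L1 = g' (u(i := 1)) \<and> L2 = g' u"
        by (auto simp: doubleton_eq_iff)
      then show "?\<phi> L2 t \<otimes>\<^bsub>study_group\<^esub> inv\<^bsub>study_group\<^esub> (?\<phi> L1 t)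
          \<in> rotation_subgroup (joint_quat M J)"
        using fwd bwd g'(2) J by auto
    qed
  next
    show "range (induced_map (F (g (g' u1)))) = range (induced_map (F u1))" using g' top by simp
  qed blast
  moreover have "g' u1 \<in> links M" using g' top by (simp add: M_def)
  moreover have "card (links M) = 2 ^ n" "card (joints M) = n * 2 ^ (n - 1)" by (simp_all add: M_def)
  ultimately show ?thesis by blast
qed

theorem theorem11:
  fixes n :: nat and C :: "dual_quat set set"
  assumes "n > 0"
    and "generic_rational_curve n C"
  shows "\<exists>M :: (nat, nat) mechanism.
    revolute_mechanism M \<and>
    card (links M) = 2 ^ n \<and>
    card (joints M) = n * 2 ^ (n - 1) \<and>
    link_graph_is_hypercube n M \<and>
    (\<exists>L\<in>links M. contained_in_motion C M L)"
proof -
  from assms(2) obtain P0 S where P0: "lead_coeff P0 = 1" "degree P0 = n" "C = range (induced_map P0)"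
    and S: "quadratic_factors S" "card S = n"
      "poly_prod P0 (map_poly qconj P0) = map_poly of_real (\<Prod>S)"
    unfolding generic_rational_curve_def generic_motion_polynomial_def motion_polynomial_def
      quadratic_factors_def by blast
  obtain P where P: "of_quat_poly P = P0" using ex_of_quat_poly by blast
  have mP: "motion S P" using motion_polynomial_imp_motion P P0 S by blast
  have "finite S" using S(1) by (simp add: quadratic_factors_def)
  then obtain e where e: "bij_betw e {0..<n} S" using ex_bij_betw_nat_finite S(2) by blast
  define T where "T u = e ` {i. i < n \<and> u i = 1}" for u :: "nat \<Rightarrow> nat"
  \<comment> \<open>\<open>T\<close> identifies the vertices of the cube with the subsets of \<open>S\<close>.\<close>
  have TS: "T u \<subseteq> S" for u using bij_betwE[OF e] by (auto simp: T_def)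
  define F where "F u = of_quat_poly (right_factor S P (T u))" for u
  note T_factors = quadratic_factors_subset[OF S(1) TS]
  note T_motion = right_factor(1)[OF S(1) mP TS]
  have "\<exists>h. rotation_quaternion h \<and>
      (\<forall>t. induced_map (F ((snd a)(fst a := 1))) t \<otimes>\<^bsub>study_group\<^esub>
        inv\<^bsub>study_group\<^esub> (induced_map (F (snd a)) t) \<in> rotation_subgroup h)"
    if "a \<in> cube_arrows n" for a
  proof -
    obtain i u where a: "a = (i, u)" by force
    then have i: "i < n" "u i = 0" using that by (auto simp: cube_arrows_def)
    have in_T: "e i \<in> T (u(i := 1))" using i by (auto simp: T_def)
    have T_diff: "T (u(i := 1)) - {e i} = T u"
    proof -
      have "T (u(i := 1)) = e ` insert i {j. j < n \<and> u j = 1}"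
        unfolding T_def using i by (intro arg_cong[of _ _ "(`) e"]) auto
      moreover have "e i \<notin> T u"
        using i bij_betw_imp_inj_on[OF e] by (auto simp: T_def dest!: inj_onD)
      ultimately show ?thesis by (auto simp: T_def)
    qed
    obtain L where L: "motion {e i} L"
      "right_factor S P (T (u(i := 1))) = L * right_factor S P (T u)"
      using right_factor_step[OF S(1) mP TS in_T] T_diff by metis
    have "motion (T (u(i := 1)) - {e i}) (right_factor S P (T u))"
      unfolding T_diff by (rule T_motion)
    from motion_induced_map_quotient[OF T_factors in_T this L(1)]
    show ?thesis unfolding F_def a fst_conv snd_conv L(2) by metis
  qed
  then obtain h where h: "\<And>a. a \<in> cube_arrows n \<Longrightarrow> rotation_quaternion (h a) \<and>
      (\<forall>t. induced_map (F ((snd a)(fst a := 1))) t \<otimes>\<^bsub>study_group\<^esub>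
        inv\<^bsub>study_group\<^esub> (induced_map (F (snd a)) t) \<in> rotation_subgroup (h a))"
    by metis
  define bot top where "bot = restrict (\<lambda>_. 0::nat) {..<n}" and "top = restrict (\<lambda>_. 1::nat) {..<n}"
  have vert: "bot \<in> cube_vertices n" "top \<in> cube_vertices n"
    by (auto simp: bot_def top_def cube_vertices_def)
  have "T bot = {}" by (auto simp: T_def bot_def)
  then have "F bot = of_quat_poly 1" using right_factor_empty[OF S(1) mP] by (simp add: F_def)
  then have base: "induced_map (F bot) t = \<one>\<^bsub>study_group\<^esub>" for t
    using motion_induced_map[of "{}" 1 t]
    by (auto simp: motion_empty_iff study_group_one qeval_one split: option.split)
  have "T top = S" using bij_betw_imp_surj_on[OF e] by (auto simp: T_def top_def)
  then have "F top = P0" using right_factor_full[OF S(1) mP] P by (simp add: F_def)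
  show ?thesis
    unfolding P0(3) \<open>F top = P0\<close>[symmetric]
  proof (rule hypercube_mechanism[where h = h and ?u0.0 = bot and ?u1.0 = top])
    fix i u t assume "(i, u) \<in> cube_arrows n"
    then show "induced_map (F (u(i := 1))) t \<otimes>\<^bsub>study_group\<^esub>
        inv\<^bsub>study_group\<^esub> (induced_map (F u) t) \<in> rotation_subgroup (h (i, u))"
      using h[of "(i, u)"] by simp
  next
    fix u t
    show "induced_map (F u) t \<in> carrier study_group"
      unfolding F_def by (rule motion_induced_map_carrier[OF T_factors T_motion])
  qed (use h base vert in auto)
qed

end
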